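(* Let $k$ be a field, $\mathfrak{g}$ a Lie algebra over $k$, $\mathfrak{h}$ an ideal of $\mathfrak{g}$ and $M$ a $\mathfrak{g}$-module. Then the sequence $$H^1(\mathfrak{h},M)^{\mathfrak{g}/\mathfrak{h}}\xrightarrow{\ \mathrm{tr}\ }H^2(\mathfrak{g}/\mathfrak{h},M^{\mathfrak{h}})\xrightarrow{\ \inf\ }H^2(\mathfrak{g},M)$$ is exact, where $\mathrm{tr}$ is the map described in the context.
   Context: Derivations and $H^1$: for a Lie algebra $\mathfrak{a}$ over $k$ and an $\mathfrak{a}$-module $N$, $\mathrm{Der}(\mathfrak{a},N)$ is the space of $k$-linear maps $d:\mathfrak{a}\to N$ with $d[x,y]=x\cdot d(y)-y\cdot d(x)$; $\delta(n)$ denotes the inner derivation $x\mapsto x\cdot n$; $\mathrm{Inn}(\mathfrak{a},N)=\{\delta(n)\}$ and $H^1(\mathfrak{a},N)=\mathrm{Der}(\mathfrak{a},N)/\mathrm{Inn}(\mathfrak{a},N)$. $M^{\mathfrak{h}}=\{m\in M: z\cdot m=0\ \forall z\in\mathfrak{h}\}$, a $\mathfrak{g}/\mathfrak{h}$-module. $\mathfrak{g}$ acts on $\mathrm{Der}(\mathfrak{h},M)$ by $({}^xd)(z)=x\cdot d(z)-d[x,z]$; this induces an action of $\mathfrak{g}/\mathfrak{h}$ on $H^1(\mathfrak{h},M)$, and $H^1(\mathfrak{h},M)^{\mathfrak{g}/\mathfrak{h}}$ is the subspace of elements annihilated by $\mathfrak{g}/\mathfrak{h}$. $\mathrm{Der}(\mathfrak{h},M)^{\mathfrak{g}/\mathfrak{h}}$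 denotes the preimage of $H^1(\mathfrak{h},M)^{\mathfrak{g}/\mathfrak{h}}$ in $\mathrm{Der}(\mathfrak{h},M)$. $H^2$: $H^2(\mathfrak{a},N)$ is identified with equivalence classes of Lie algebra extensions $0\to N\xrightarrow{i}\mathfrak{e}\to\mathfrak{a}\to0$ ($N$ abelian) whose induced action $i(x\cdot n)=[\tilde x,i(n)]$ ($\tilde x$ a lift of $x$) is the given module structure; the class of an extension corresponds to that of the 2-cocycle $f(x,y)=[s(x),s(y)]-s[x,y]$ for a linear section $s$. The map $\inf$ is induced by $\mathfrak{g}\to\mathfrak{g}/\mathfrak{h}$ and $M^{\mathfrak{h}}\hookrightarrow M$. The map $\mathrm{tr}$: $M\rtimes\mathfrak{g}$ has bracket $[(m,x),(m',x')]=(x\cdot m'-x'\cdot m,[x,x'])$. For $d\in\mathrm{Der}(\mathfrak{h},M)^{\mathfrak{g}/\mathfrak{h}}$ let $s_d:\mathfrak{h}\to M\rtimes\mathfrak{g}$, $s_d(z)=(d(z),z)$, a Lie algebra homomorphism, and $I=\{y\in M\rtimes\mathfrak{g}:[y,s_d(\mathfrak{h})]\subset s_d(\mathfrak{h})\}$. Then $s_d(\mathfrak{h})$ is an ideal in $I$ and $0\to M^{\mathfrak{h}}\to I/s_d(\mathfrak{h})\to\mathfrak{g}/\mathfrak{h}\to0$ (maps induced by $m\mapsto(m,0)$ and $(m,x)\mapsto x$) is an extension; $\widehat{\mathrm{tr}}(d)\in H^2(\mathfrak{g}/\mathfrak{h},M^{\mathfrak{h}})$ is its class. The map $\widehat{\mathrm{tr}}$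 depends only on $[d]\in H^1(\mathfrak{h},M)$ and $\mathrm{tr}[d]:=\widehat{\mathrm{tr}}(d)$. *)

theory Defs
  imports "HOL-Algebra.Module" "HOL-Algebra.QuotRing"
begin

text \<open>
  The record \<^typ>\<open>('k, 'v) module\<close> extends the ring record, but the locale \<^locale>\<open>module\<close> says
  nothing about the fields \<open>mult\<close> and \<open>one\<close> of a module; they play no role below and are left
  \<open>undefined\<close> in constructed modules.
\<close>

section \<open>Lie algebras and their modules\<close>

record ('k, 'g) lie_algebra = "('k, 'g) module" +
  bracket :: "'g \<Rightarrow> 'g \<Rightarrow> 'g" (\<open>\<lbrace>_, _\<rbrace>\<index>\<close>)

locale lie_algebra = K?: field K + L?: module K L
  for K :: "('k, 'c) ring_scheme" and L :: "('k, 'g, 'd) lie_algebra_scheme" (structure) +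
  assumes bracket_closed:
      "\<lbrakk>x \<in> carrier L; y \<in> carrier L\<rbrakk> \<Longrightarrow> \<lbrace>x, y\<rbrace> \<in> carrier L"
    and bracket_add_left:
      "\<lbrakk>x \<in> carrier L; y \<in> carrier L; z \<in> carrier L\<rbrakk> \<Longrightarrow> \<lbrace>x \<oplus> y, z\<rbrace> = \<lbrace>x, z\<rbrace> \<oplus> \<lbrace>y, z\<rbrace>"
    and bracket_add_right:
      "\<lbrakk>x \<in> carrier L; y \<in> carrier L; z \<in> carrier L\<rbrakk> \<Longrightarrow> \<lbrace>x, y \<oplus> z\<rbrace> = \<lbrace>x, y\<rbrace> \<oplus> \<lbrace>x, z\<rbrace>"
    and bracket_smult_left:
      "\<lbrakk>c \<in> carrier K; x \<in> carrier L; y \<in> carrier L\<rbrakk> \<Longrightarrow> \<lbrace>c \<odot> x, y\<rbrace> = c \<odot> \<lbrace>x, y\<rbrace>"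
    and bracket_smult_right:
      "\<lbrakk>c \<in> carrier K; x \<in> carrier L; y \<in> carrier L\<rbrakk> \<Longrightarrow> \<lbrace>x, c \<odot> y\<rbrace> = c \<odot> \<lbrace>x, y\<rbrace>"
    and bracket_alternating:
      "x \<in> carrier L \<Longrightarrow> \<lbrace>x, x\<rbrace> = \<zero>"
    and jacobi:
      "\<lbrakk>x \<in> carrier L; y \<in> carrier L; z \<in> carrier L\<rbrakk> \<Longrightarrow>
        \<lbrace>x, \<lbrace>y, z\<rbrace>\<rbrace> \<oplus> \<lbrace>y, \<lbrace>z, x\<rbrace>\<rbrace> \<oplus> \<lbrace>z, \<lbrace>x, y\<rbrace>\<rbrace> = \<zero>"

locale lie_ideal = lie_algebra K L + submodule H K L
  for H and K and L (structure) +
  assumes ideal_closed: "\<lbrakk>x \<in> carrier L; z \<in> H\<rbrakk> \<Longrightarrow> \<lbrace>x, z\<rbrace> \<in> H"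

record ('k, 'g, 'm) lie_module = "('k, 'm) module" +
  act :: "'g \<Rightarrow> 'm \<Rightarrow> 'm" (infixr \<open>\<rhd>\<index>\<close> 75)

locale lie_module = lie_algebra K L + M?: module K M
  for K :: "('k, 'c) ring_scheme" and L :: "('k, 'g, 'd) lie_algebra_scheme" (structure)
    and M :: "('k, 'g, 'm, 'e) lie_module_scheme" (structure) +
  assumes act_closed:
      "\<lbrakk>x \<in> carrier L; m \<in> carrier M\<rbrakk> \<Longrightarrow> x \<rhd>\<^bsub>M\<^esub> m \<in> carrier M"
    and act_add_left:
      "\<lbrakk>x \<in> carrier L; y \<in> carrier L; m \<in> carrier M\<rbrakk> \<Longrightarrow>
        (x \<oplus>\<^bsub>L\<^esub> y) \<rhd>\<^bsub>M\<^esub> m = (x \<rhd>\<^bsub>M\<^esub> m) \<oplus>\<^bsub>M\<^esub> (y \<rhd>\<^bsub>M\<^esub> m)"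
    and act_add_right:
      "\<lbrakk>x \<in> carrier L; m \<in> carrier M; n \<in> carrier M\<rbrakk> \<Longrightarrow>
        x \<rhd>\<^bsub>M\<^esub> (m \<oplus>\<^bsub>M\<^esub> n) = (x \<rhd>\<^bsub>M\<^esub> m) \<oplus>\<^bsub>M\<^esub> (x \<rhd>\<^bsub>M\<^esub> n)"
    and act_smult_left:
      "\<lbrakk>c \<in> carrier K; x \<in> carrier L; m \<in> carrier M\<rbrakk> \<Longrightarrow>
        (c \<odot>\<^bsub>L\<^esub> x) \<rhd>\<^bsub>M\<^esub> m = c \<odot>\<^bsub>M\<^esub> (x \<rhd>\<^bsub>M\<^esub> m)"
    and act_smult_right:
      "\<lbrakk>c \<in> carrier K; x \<in> carrier L; m \<in> carrier M\<rbrakk> \<Longrightarrow>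
        x \<rhd>\<^bsub>M\<^esub> (c \<odot>\<^bsub>M\<^esub> m) = c \<odot>\<^bsub>M\<^esub> (x \<rhd>\<^bsub>M\<^esub> m)"
    and act_bracket:
      "\<lbrakk>x \<in> carrier L; y \<in> carrier L; m \<in> carrier M\<rbrakk> \<Longrightarrow>
        \<lbrace>x, y\<rbrace>\<^bsub>L\<^esub> \<rhd>\<^bsub>M\<^esub> m = (x \<rhd>\<^bsub>M\<^esub> (y \<rhd>\<^bsub>M\<^esub> m)) \<ominus>\<^bsub>M\<^esub> (y \<rhd>\<^bsub>M\<^esub> (x \<rhd>\<^bsub>M\<^esub> m))"


section \<open>Linear maps, quotients, exactness\<close>

definition lin_hom :: "('k, 'c) ring_scheme \<Rightarrow> ('k, 'v, 'd) module_scheme \<Rightarrow>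
    ('k, 'w, 'e) module_scheme \<Rightarrow> ('v \<Rightarrow> 'w) set" where
  "lin_hom K V W = {f \<in> hom (add_monoid V) (add_monoid W).
     \<forall>c\<in>carrier K. \<forall>v\<in>carrier V. f (c \<odot>\<^bsub>V\<^esub> v) = c \<odot>\<^bsub>W\<^esub> f v}"

definition exact_at :: "('k, 'c) ring_scheme \<Rightarrow> ('k, 'u, 'd) module_scheme \<Rightarrow> ('u \<Rightarrow> 'v) \<Rightarrow>
    ('k, 'v, 'e) module_scheme \<Rightarrow> ('v \<Rightarrow> 'w) \<Rightarrow> ('k, 'w, 'f) module_scheme \<Rightarrow> bool" where
  "exact_at K U f V g W \<longleftrightarrow>
     f \<in> lin_hom K U V \<and> g \<in> lin_hom K V W \<and> f ` carrier U = a_kernel V W g"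

text \<open>Quotients consist of cosets, with operations as for \<^const>\<open>FactRing\<close>.\<close>

definition quot_module :: "('k, 'v, 'd) module_scheme \<Rightarrow> 'v set \<Rightarrow> ('k, 'v set) module" where
  "quot_module V W =
    \<lparr>carrier = a_rcosets\<^bsub>V\<^esub> W, mult = undefined, one = undefined, zero = W, add = set_add V,
     smult = (\<lambda>c A. \<Union>a\<in>A. W +>\<^bsub>V\<^esub> (c \<odot>\<^bsub>V\<^esub> a))\<rparr>"

definition quot_lie :: "('k, 'g, 'd) lie_algebra_scheme \<Rightarrow> 'g set \<Rightarrow> ('k, 'g set) lie_algebra" where
  "quot_lie L H =
    \<lparr>carrier = a_rcosets\<^bsub>L\<^esub> H, mult = undefined, one = undefined, zero = H, add = set_add L,
     smult = smult (quot_module L H),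
     bracket = (\<lambda>A B. \<Union>a\<in>A. \<Union>b\<in>B. H +>\<^bsub>L\<^esub> \<lbrace>a, b\<rbrace>\<^bsub>L\<^esub>)\<rparr>"

definition fun_module :: "'s set \<Rightarrow> ('k, 'n, 'd) module_scheme \<Rightarrow> ('k, 's \<Rightarrow> 'n) module" where
  "fun_module S N =
    \<lparr>carrier = S \<rightarrow>\<^sub>E carrier N, mult = undefined, one = undefined, zero = (\<lambda>s\<in>S. \<zero>\<^bsub>N\<^esub>),
     add = (\<lambda>f g. \<lambda>s\<in>S. f s \<oplus>\<^bsub>N\<^esub> g s), smult = (\<lambda>c f. \<lambda>s\<in>S. c \<odot>\<^bsub>N\<^esub> f s)\<rparr>"


section \<open>Low-degree cohomology\<close>

definition Der :: "('k, 'c) ring_scheme \<Rightarrow> ('k, 'g, 'd) lie_algebra_scheme \<Rightarrow>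
    ('k, 'g, 'n, 'e) lie_module_scheme \<Rightarrow> ('g \<Rightarrow> 'n) set" where
  "Der K A N = {d \<in> lin_hom K A N \<inter> extensional (carrier A).
     \<forall>x\<in>carrier A. \<forall>y\<in>carrier A. d \<lbrace>x, y\<rbrace>\<^bsub>A\<^esub> = (x \<rhd>\<^bsub>N\<^esub> d y) \<ominus>\<^bsub>N\<^esub> (y \<rhd>\<^bsub>N\<^esub> d x)}"

definition Inn :: "('k, 'g, 'd) lie_algebra_scheme \<Rightarrow> ('k, 'g, 'n, 'e) lie_module_scheme \<Rightarrow>
    ('g \<Rightarrow> 'n) set" where
  "Inn A N = (\<lambda>n. \<lambda>x\<in>carrier A. x \<rhd>\<^bsub>N\<^esub> n) ` carrier N"

definition H1 :: "('k, 'c) ring_scheme \<Rightarrow> ('k, 'g, 'd) lie_algebra_scheme \<Rightarrow>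
    ('k, 'g, 'n, 'e) lie_module_scheme \<Rightarrow> ('k, ('g \<Rightarrow> 'n) set) module" where
  "H1 K A N = quot_module ((fun_module (carrier A) N)\<lparr>carrier := Der K A N\<rparr>) (Inn A N)"

text \<open>The second cohomology in terms of alternating bilinear cocycles modulo coboundaries of linear
  maps.\<close>

definition Z2 :: "('k, 'c) ring_scheme \<Rightarrow> ('k, 'g, 'd) lie_algebra_scheme \<Rightarrow>
    ('k, 'g, 'n, 'e) lie_module_scheme \<Rightarrow> ('g \<times> 'g \<Rightarrow> 'n) set" where
  "Z2 K A N = {f \<in> carrier A \<times> carrier A \<rightarrow>\<^sub>E carrier N.
     (\<forall>x\<in>carrier A. (\<lambda>y. f (x, y)) \<in> lin_hom K A N) \<and>
     (\<forall>y\<in>carrier A. (\<lambda>x. f (x, y)) \<in> lin_hom K A N) \<and>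
     (\<forall>x\<in>carrier A. f (x, x) = \<zero>\<^bsub>N\<^esub>) \<and>
     (\<forall>x\<in>carrier A. \<forall>y\<in>carrier A. \<forall>z\<in>carrier A.
        (x \<rhd>\<^bsub>N\<^esub> f (y, z)) \<oplus>\<^bsub>N\<^esub> (y \<rhd>\<^bsub>N\<^esub> f (z, x)) \<oplus>\<^bsub>N\<^esub> (z \<rhd>\<^bsub>N\<^esub> f (x, y)) =
        f (\<lbrace>x, y\<rbrace>\<^bsub>A\<^esub>, z) \<oplus>\<^bsub>N\<^esub> f (\<lbrace>y, z\<rbrace>\<^bsub>A\<^esub>, x) \<oplus>\<^bsub>N\<^esub> f (\<lbrace>z, x\<rbrace>\<^bsub>A\<^esub>, y))}"

definition B2 :: "('k, 'c) ring_scheme \<Rightarrow> ('k, 'g, 'd) lie_algebra_scheme \<Rightarrow>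
    ('k, 'g, 'n, 'e) lie_module_scheme \<Rightarrow> ('g \<times> 'g \<Rightarrow> 'n) set" where
  "B2 K A N = (\<lambda>\<phi>. \<lambda>(x, y)\<in>carrier A \<times> carrier A.
     (x \<rhd>\<^bsub>N\<^esub> \<phi> y) \<ominus>\<^bsub>N\<^esub> (y \<rhd>\<^bsub>N\<^esub> \<phi> x) \<ominus>\<^bsub>N\<^esub> \<phi> \<lbrace>x, y\<rbrace>\<^bsub>A\<^esub>) ` lin_hom K A N"

definition H2 :: "('k, 'c) ring_scheme \<Rightarrow> ('k, 'g, 'd) lie_algebra_scheme \<Rightarrow>
    ('k, 'g, 'n, 'e) lie_module_scheme \<Rightarrow> ('k, ('g \<times> 'g \<Rightarrow> 'n) set) module" where
  "H2 K A N =
     quot_module ((fun_module (carrier A \<times> carrier A) N)\<lparr>carrier := Z2 K A N\<rparr>) (B2 K A N)"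

definition H2_class :: "('k, 'c) ring_scheme \<Rightarrow> ('k, 'g, 'd) lie_algebra_scheme \<Rightarrow>
    ('k, 'g, 'n, 'e) lie_module_scheme \<Rightarrow> ('g \<times> 'g \<Rightarrow> 'n) \<Rightarrow> ('g \<times> 'g \<Rightarrow> 'n) set" where
  "H2_class K A N f = B2 K A N +>\<^bsub>fun_module (carrier A \<times> carrier A) N\<^esub> f"

text \<open>
  The class of an extension \<open>0 \<rightarrow> N \<rightarrow> E \<rightarrow> A \<rightarrow> 0\<close> with maps \<open>i\<close> and \<open>p\<close>: all linear sections
  \<open>s\<close> of \<open>p\<close> have cocycles \<open>[s x, s y] - s [x, y]\<close> of the same class.  As for homomorphisms out of
  factor groups in the library, \<^const>\<open>the_elem\<close> selects that common value, here and below.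
\<close>

definition sections :: "('k, 'c) ring_scheme \<Rightarrow> ('k, 'x, 'd) lie_algebra_scheme \<Rightarrow>
    ('k, 'g, 'e) lie_algebra_scheme \<Rightarrow> ('x \<Rightarrow> 'g) \<Rightarrow> ('g \<Rightarrow> 'x) set" where
  "sections K E A p = {s \<in> lin_hom K A E. \<forall>x\<in>carrier A. p (s x) = x}"

definition section_cocycle :: "('k, 'g, 'n, 'c) lie_module_scheme \<Rightarrow>
    ('k, 'x, 'd) lie_algebra_scheme \<Rightarrow> ('k, 'g, 'e) lie_algebra_scheme \<Rightarrow>
    ('n \<Rightarrow> 'x) \<Rightarrow> ('g \<Rightarrow> 'x) \<Rightarrow> ('g \<times> 'g \<Rightarrow> 'n)" where
  "section_cocycle N E A i s = (\<lambda>(x, y)\<in>carrier A \<times> carrier A.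
     inv_into (carrier N) i (\<lbrace>s x, s y\<rbrace>\<^bsub>E\<^esub> \<ominus>\<^bsub>E\<^esub> s \<lbrace>x, y\<rbrace>\<^bsub>A\<^esub>))"

definition extension_class :: "('k, 'c) ring_scheme \<Rightarrow> ('k, 'g, 'n, 'd) lie_module_scheme \<Rightarrow>
    ('k, 'x, 'e) lie_algebra_scheme \<Rightarrow> ('k, 'g, 'f) lie_algebra_scheme \<Rightarrow>
    ('n \<Rightarrow> 'x) \<Rightarrow> ('x \<Rightarrow> 'g) \<Rightarrow> ('g \<times> 'g \<Rightarrow> 'n) set" where
  "extension_class K N E A i p =
     the_elem ((\<lambda>s. H2_class K A N (section_cocycle N E A i s)) ` sections K E A p)"


section \<open>Invariants under an ideal\<close>

definition annihilated :: "'g set \<Rightarrow> ('k, 'g, 'm, 'd) lie_module_scheme \<Rightarrow> 'm set" where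
  "annihilated S M = {m \<in> carrier M. \<forall>z\<in>S. z \<rhd>\<^bsub>M\<^esub> m = \<zero>\<^bsub>M\<^esub>}"

text \<open>The module \<open>M\<^sup>H\<close> over the quotient by \<open>H\<close>.\<close>

definition ideal_invariants :: "'g set \<Rightarrow> ('k, 'g, 'm, 'd) lie_module_scheme \<Rightarrow>
    ('k, 'g set, 'm) lie_module" where
  "ideal_invariants H M =
    \<lparr>carrier = annihilated H M, mult = undefined, one = undefined, zero = \<zero>\<^bsub>M\<^esub>, add = add M,
     smult = smult M, act = (\<lambda>X m. the_elem ((\<lambda>x. x \<rhd>\<^bsub>M\<^esub> m) ` X))\<rparr>"

definition der_act :: "('k, 'g, 'd) lie_algebra_scheme \<Rightarrow> 'g set \<Rightarrow>
    ('k, 'g, 'm, 'e) lie_module_scheme \<Rightarrow> 'g \<Rightarrow> ('g \<Rightarrow> 'm) \<Rightarrow> ('g \<Rightarrow> 'm)" where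
  "der_act L H M x d = (\<lambda>z\<in>H. (x \<rhd>\<^bsub>M\<^esub> d z) \<ominus>\<^bsub>M\<^esub> d \<lbrace>x, z\<rbrace>\<^bsub>L\<^esub>)"

text \<open>The first cohomology of the ideal \<open>H\<close>, with the induced action of the quotient by \<open>H\<close>.\<close>

definition H1_ideal :: "('k, 'c) ring_scheme \<Rightarrow> ('k, 'g, 'd) lie_algebra_scheme \<Rightarrow> 'g set \<Rightarrow>
    ('k, 'g, 'm, 'e) lie_module_scheme \<Rightarrow> ('k, 'g set, ('g \<Rightarrow> 'm) set) lie_module" where
  "H1_ideal K L H M = (let V = H1 K (L\<lparr>carrier := H\<rparr>) M in
    \<lparr>carrier = carrier V, mult = undefined, one = undefined, zero = zero V, add = add V,
     smult = smult V,
     act = (\<lambda>X C. \<Union>x\<in>X. \<Union>d\<in>C. Inn (L\<lparr>carrier := H\<rparr>) M +>\<^bsub>fun_module H M\<^esub> der_act L H M x d)\<rparr>)"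

definition H1_invariants :: "('k, 'c) ring_scheme \<Rightarrow> ('k, 'g, 'd) lie_algebra_scheme \<Rightarrow> 'g set \<Rightarrow>
    ('k, 'g, 'm, 'e) lie_module_scheme \<Rightarrow> ('k, 'g set, ('g \<Rightarrow> 'm) set) lie_module" where
  "H1_invariants K L H M =
     (H1_ideal K L H M)\<lparr>carrier := annihilated (carrier (quot_lie L H)) (H1_ideal K L H M)\<rparr>"


section \<open>Inflation and transgression\<close>

definition inflate :: "('k, 'g, 'd) lie_algebra_scheme \<Rightarrow> 'g set \<Rightarrow>
    ('g set \<times> 'g set \<Rightarrow> 'm) \<Rightarrow> ('g \<times> 'g \<Rightarrow> 'm)" where
  "inflate L H f = (\<lambda>(x, y)\<in>carrier L \<times> carrier L. f (H +>\<^bsub>L\<^esub> x, H +>\<^bsub>L\<^esub> y))"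

definition inflation :: "('k, 'c) ring_scheme \<Rightarrow> ('k, 'g, 'd) lie_algebra_scheme \<Rightarrow> 'g set \<Rightarrow>
    ('k, 'g, 'm, 'e) lie_module_scheme \<Rightarrow> ('g set \<times> 'g set \<Rightarrow> 'm) set \<Rightarrow>
    ('g \<times> 'g \<Rightarrow> 'm) set" where
  "inflation K L H M C = the_elem ((\<lambda>f. H2_class K L M (inflate L H f)) ` C)"

definition semidirect :: "('k, 'g, 'm, 'd) lie_module_scheme \<Rightarrow> ('k, 'g, 'e) lie_algebra_scheme \<Rightarrow>
    ('k, 'm \<times> 'g) lie_algebra" where
  "semidirect M L =
    \<lparr>carrier = carrier M \<times> carrier L, mult = undefined, one = undefined,
     zero = (\<zero>\<^bsub>M\<^esub>, \<zero>\<^bsub>L\<^esub>),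
     add = (\<lambda>(m, x) (n, y). (m \<oplus>\<^bsub>M\<^esub> n, x \<oplus>\<^bsub>L\<^esub> y)),
     smult = (\<lambda>c (m, x). (c \<odot>\<^bsub>M\<^esub> m, c \<odot>\<^bsub>L\<^esub> x)),
     bracket = (\<lambda>(m, x) (n, y). ((x \<rhd>\<^bsub>M\<^esub> n) \<ominus>\<^bsub>M\<^esub> (y \<rhd>\<^bsub>M\<^esub> m), \<lbrace>x, y\<rbrace>\<^bsub>L\<^esub>))\<rparr>"

definition lie_normalizer :: "('k, 'g, 'd) lie_algebra_scheme \<Rightarrow> 'g set \<Rightarrow> 'g set" where
  "lie_normalizer L S = {y \<in> carrier L. \<forall>s\<in>S. \<lbrace>y, s\<rbrace>\<^bsub>L\<^esub> \<in> S}"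

text \<open>
  The extension of the quotient by \<open>M\<^sup>H\<close> attached to a derivation \<open>d\<close> of \<open>H\<close>: the graph of
  \<open>d\<close>, the algebra in the middle, and the two maps.  This is an extension when \<open>d\<close> represents an
  invariant class, that is, when it is an element of an element of \<^term>\<open>carrier (H1_invariants K L H M)\<close>.
\<close>

definition der_graph :: "'g set \<Rightarrow> ('g \<Rightarrow> 'm) \<Rightarrow> ('m \<times> 'g) set" where
  "der_graph H d = (\<lambda>z. (d z, z)) ` H"

definition tr_algebra :: "('k, 'g, 'd) lie_algebra_scheme \<Rightarrow> 'g set \<Rightarrow>
    ('k, 'g, 'm, 'e) lie_module_scheme \<Rightarrow> ('g \<Rightarrow> 'm) \<Rightarrow> ('k, ('m \<times> 'g) set) lie_algebra" where
  "tr_algebra L H M d =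
     quot_lie ((semidirect M L)\<lparr>carrier := lie_normalizer (semidirect M L) (der_graph H d)\<rparr>)
       (der_graph H d)"

definition tr_incl :: "('k, 'g, 'd) lie_algebra_scheme \<Rightarrow> 'g set \<Rightarrow>
    ('k, 'g, 'm, 'e) lie_module_scheme \<Rightarrow> ('g \<Rightarrow> 'm) \<Rightarrow> 'm \<Rightarrow> ('m \<times> 'g) set" where
  "tr_incl L H M d m = der_graph H d +>\<^bsub>semidirect M L\<^esub> (m, \<zero>\<^bsub>L\<^esub>)"

definition tr_proj :: "('k, 'g, 'd) lie_algebra_scheme \<Rightarrow> 'g set \<Rightarrow> ('m \<times> 'g) set \<Rightarrow> 'g set" where
  "tr_proj L H Y = the_elem ((\<lambda>(m, x). H +>\<^bsub>L\<^esub> x) ` Y)"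

definition tr_hat :: "('k, 'c) ring_scheme \<Rightarrow> ('k, 'g, 'd) lie_algebra_scheme \<Rightarrow> 'g set \<Rightarrow>
    ('k, 'g, 'm, 'e) lie_module_scheme \<Rightarrow> ('g \<Rightarrow> 'm) \<Rightarrow> ('g set \<times> 'g set \<Rightarrow> 'm) set" where
  "tr_hat K L H M d =
     extension_class K (ideal_invariants H M) (tr_algebra L H M d) (quot_lie L H)
       (tr_incl L H M d) (tr_proj L H)"

definition tr :: "('k, 'c) ring_scheme \<Rightarrow> ('k, 'g, 'd) lie_algebra_scheme \<Rightarrow> 'g set \<Rightarrow>
    ('k, 'g, 'm, 'e) lie_module_scheme \<Rightarrow> ('g \<Rightarrow> 'm) set \<Rightarrow> ('g set \<times> 'g set \<Rightarrow> 'm) set" where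
  "tr K L H M C = the_elem (tr_hat K L H M ` C)"

end

(* A 1-cochain \<phi> on g with values in M is called relative if its coboundary vanishes on g x h.
   The coboundary of such a cochain descends to a 2-cocycle f of g/h with values in the
   h-invariants of M, and the restriction of \<phi> to h is a derivation with invariant class.
   The linear sections of the extension attached to a derivation d of h correspond to the
   relative cochains \<phi> extending d, the cocycle of the section being f; so tr maps the class of
   \<phi> restricted to h to the class of f. Extensions of d exist since the projection of the
   normalizer of the graph of d onto g has a linear section that extends the graph.
   As inf sends the class of f to the class of the coboundary of \<phi>, inf o tr = 0; conversely,
   if the inflation of a cocycle f of g/h is the coboundary of some \<phi>, then \<phi> is relative,
   because the inflation vanishes on g x h, and f is the cocycle obtained from \<phi>. *)

theory Submission
  imports Defs
begin

section \<open>Linear maps and quotients\<close>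

text \<open>The maps \<open>tr\<close> and \<open>inflation\<close> are given by
  \<open>the_elem\<close> over all sections or all representatives, so evaluating them means proving
  constancy. For \<open>tr\<close> two ambiguities occur. Adding to a derivation d the inner
  derivation of n adds the cochain x |-> x . n to \<phi>; its coboundary is zero, so even the
  cocycle stays the same. Replacing \<phi> by another relative cochain with the same restriction to
  h changes \<phi> by a linear map that vanishes on h. Since z . \<phi> x is determined by that
  restriction for z in h, the change has values in the h-invariants, so it comes from a 1-cochain of
  g/h, and the cocycle changes by the coboundary of the latter. Invariance of the class of d is used
  to find \<phi>: a pair (m, x) normalizes the graph of d exactly when x acts on d as the inner
  derivation of m, so invariance says that the normalizer projects onto g. A linear section with
  prescribed values on h then exists over any field by Zorn's lemma, in arbitrary dimension.\<close>

context abelian_group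
begin

lemma minus_eq_iff:
  "\<lbrakk>x \<in> carrier G; y \<in> carrier G; z \<in> carrier G\<rbrakk> \<Longrightarrow> x \<ominus> y = z \<longleftrightarrow> x = z \<oplus> y"
  by (metis a_minus_def add.inv_solve_right)

lemma eq_minus_iff:
  "\<lbrakk>x \<in> carrier G; y \<in> carrier G; z \<in> carrier G\<rbrakk> \<Longrightarrow> z = x \<ominus> y \<longleftrightarrow> z \<oplus> y = x"
  by (metis minus_eq_iff)

lemma minus_add_swap:
  "\<lbrakk>x \<in> carrier G; y \<in> carrier G; z \<in> carrier G\<rbrakk> \<Longrightarrow> (x \<ominus> y) \<oplus> z = (x \<oplus> z) \<ominus> y"
  by (simp add: a_minus_def a_ac)

lemma add_minus_assoc:
  "\<lbrakk>x \<in> carrier G; y \<in> carrier G; z \<in> carrier G\<rbrakk> \<Longrightarrow> z \<oplus> (x \<ominus> y) = (z \<oplus> x) \<ominus> y"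
  by (simp add: a_minus_def a_ac)

lemma minus_minus_left:
  "\<lbrakk>x \<in> carrier G; y \<in> carrier G; z \<in> carrier G\<rbrakk> \<Longrightarrow> (x \<ominus> y) \<ominus> z = x \<ominus> (y \<oplus> z)"
  by (simp add: a_minus_def minus_add a_ac)

lemma minus_minus_right:
  "\<lbrakk>x \<in> carrier G; y \<in> carrier G; z \<in> carrier G\<rbrakk> \<Longrightarrow> x \<ominus> (y \<ominus> z) = (x \<oplus> z) \<ominus> y"
  by (simp add: a_minus_def minus_add a_ac)

lemma a_inv_eq_minus: "x \<in> carrier G \<Longrightarrow> \<ominus> x = \<zero> \<ominus> x"
  by (simp add: a_minus_def)

text \<open>These rules turn an equation in an abelian group into one between sums without negation, where
  no cancellation is needed and AC rewriting suffices.\<close>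

lemmas minus_simps = minus_eq_iff eq_minus_iff minus_add_swap add_minus_assoc minus_minus_left
  minus_minus_right a_inv_eq_minus a_ac

end

section \<open>Linear maps and the extension of partial sections\<close>

lemma lin_homI:
  assumes "\<And>v. v \<in> carrier V \<Longrightarrow> f v \<in> carrier W"
    and "\<And>u v. \<lbrakk>u \<in> carrier V; v \<in> carrier V\<rbrakk> \<Longrightarrow> f (u \<oplus>\<^bsub>V\<^esub> v) = f u \<oplus>\<^bsub>W\<^esub> f v"
    and "\<And>c v. \<lbrakk>c \<in> carrier K; v \<in> carrier V\<rbrakk> \<Longrightarrow> f (c \<odot>\<^bsub>V\<^esub> v) = c \<odot>\<^bsub>W\<^esub> f v"
  shows "f \<in> lin_hom K V W"
  using assms by (auto simp: lin_hom_def hom_def)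

lemma lin_hom_closed: "\<lbrakk>f \<in> lin_hom K V W; v \<in> carrier V\<rbrakk> \<Longrightarrow> f v \<in> carrier W"
  by (auto simp: lin_hom_def hom_def)

lemma lin_hom_add:
  "\<lbrakk>f \<in> lin_hom K V W; u \<in> carrier V; v \<in> carrier V\<rbrakk> \<Longrightarrow> f (u \<oplus>\<^bsub>V\<^esub> v) = f u \<oplus>\<^bsub>W\<^esub> f v"
  by (auto simp: lin_hom_def hom_def)

lemma lin_hom_smult:
  "\<lbrakk>f \<in> lin_hom K V W; c \<in> carrier K; v \<in> carrier V\<rbrakk> \<Longrightarrow> f (c \<odot>\<^bsub>V\<^esub> v) = c \<odot>\<^bsub>W\<^esub> f v"
  by (auto simp: lin_hom_def)

context
  fixes K V W f
  assumes VW: "abelian_group V" "abelian_group W" and f: "f \<in> lin_hom K V W"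
begin

interpretation abelian_group_hom V W f
proof (rule abelian_group_homI)
  show "group_hom (add_monoid V) (add_monoid W) f"
    using f VW by (auto simp: group_hom_def group_hom_axioms_def lin_hom_def abelian_group.a_group)
qed (rule VW)+

lemma lin_hom_zero: "f \<zero>\<^bsub>V\<^esub> = \<zero>\<^bsub>W\<^esub>"
  by (rule hom_zero)

lemma lin_hom_a_inv: "v \<in> carrier V \<Longrightarrow> f (\<ominus>\<^bsub>V\<^esub> v) = \<ominus>\<^bsub>W\<^esub> f v"
  by (rule hom_a_inv)

lemma lin_hom_minus:
  "\<lbrakk>u \<in> carrier V; v \<in> carrier V\<rbrakk> \<Longrightarrow> f (u \<ominus>\<^bsub>V\<^esub> v) = f u \<ominus>\<^bsub>W\<^esub> f v"
  by (simp add: a_minus_def)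

end

text \<open>Two elements of the union of a chain already lie in one member, so sums stay inside;
  nonemptiness of the chain supplies zero. This gives the upper bounds for Zorn's lemma.\<close>

lemma submodule_Union_chain:
  assumes "C \<noteq> {}" "subset.chain A C" "\<And>G. G \<in> A \<Longrightarrow> submodule G K V" "module K V"
  shows "submodule (\<Union>C) K V"
proof -
  interpret module K V by fact
  have C: "submodule G K V" if "G \<in> C" for G
    using assms(2,3) that by (auto simp: subset.chain_def)
  have *: "\<exists>G\<in>C. a \<in> G \<and> b \<in> G" if "a \<in> \<Union>C" "b \<in> \<Union>C" for a b
    using that assms(2) unfolding subset_chain_def by blast
  show ?thesis
  proof (rule submoduleI)
    show "\<Union>C \<subseteq> carrier V" using submoduleE(1)[OF C] by blast
    show "\<zero>\<^bsub>V\<^esub> \<in> \<Union>C"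
      using C assms(1) subgroup.one_closed[OF submodule.axioms(1)] by fastforce
    show "\<ominus>\<^bsub>V\<^esub> a \<in> \<Union>C" if "a \<in> \<Union>C" for a
      using that submoduleE(3)[OF C] by blast
    show "c \<odot>\<^bsub>V\<^esub> a \<in> \<Union>C" if "c \<in> carrier K" "a \<in> \<Union>C" for c a
      using that submoduleE(4)[OF C] by blast
    show "a \<oplus>\<^bsub>V\<^esub> b \<in> \<Union>C" if ab: "a \<in> \<Union>C" "b \<in> \<Union>C" for a b
      using *[OF ab] submoduleE(5)[OF C] by blast
  qed
qed

text \<open>Take a submodule G that is maximal among those containing P on which q is injective.
  Then q maps G onto W, and the inverse of q on G is the section; it returns P pointwise because P
  lies in G. Prescribing the section on q(P) is what later makes a cochain on g restrict to a given
  derivation of h.\<close>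

lemma linear_section_extending:
  fixes K (structure) and V :: "('k, 'v, 'd) module_scheme" and W :: "('k, 'w, 'e) module_scheme"
  assumes "field K" "module K V" "module K W"
    and q: "q \<in> lin_hom K V W" "q ` carrier V = carrier W"
    and P: "submodule P K V" "inj_on q P"
  shows "\<exists>s\<in>lin_hom K W V. (\<forall>w\<in>carrier W. q (s w) = w) \<and> (\<forall>p\<in>P. s (q p) = p)"
proof -
  interpret K: field K by fact
  interpret V: module K V by fact
  interpret W: module K W by fact
  note q_simps = lin_hom_closed[OF q(1)] lin_hom_add[OF q(1)] lin_hom_smult[OF q(1)]
    lin_hom_a_inv[OF V.abelian_group_axioms W.abelian_group_axioms q(1)]
    lin_hom_zero[OF V.abelian_group_axioms W.abelian_group_axioms q(1)]
  have inj_on_submodule: "inj_on q X"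
    if X: "submodule X K V" and ker: "\<And>a. \<lbrakk>a \<in> X; q a = \<zero>\<^bsub>W\<^esub>\<rbrakk> \<Longrightarrow> a = \<zero>\<^bsub>V\<^esub>" for X
  proof (rule inj_onI)
    fix a b assume ab: "a \<in> X" "b \<in> X" "q a = q b"
    note X = V.submoduleE[OF X]
    have carr: "a \<in> carrier V" "b \<in> carrier V" using X(1) ab by auto
    have "q (a \<oplus>\<^bsub>V\<^esub> \<ominus>\<^bsub>V\<^esub> b) = \<zero>\<^bsub>W\<^esub>"
      using carr ab(3) by (simp add: q_simps W.r_neg)
    then have "a \<oplus>\<^bsub>V\<^esub> \<ominus>\<^bsub>V\<^esub> b = \<zero>\<^bsub>V\<^esub>"
      using ker X(3,5) ab by blast
    then show "a = b"
      using carr by (metis V.minus_equality V.minus_minus V.a_inv_closed)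
  qed
  let ?A = "{G. submodule G K V \<and> P \<subseteq> G \<and> inj_on q G}"
  have "\<exists>G\<in>?A. \<forall>X\<in>?A. G \<subseteq> X \<longrightarrow> X = G"
  proof (rule subset_Zorn_nonempty)
    show "?A \<noteq> {}" using P by blast
    fix C assume C: "C \<noteq> {}" "subset.chain ?A C"
    have "inj_on q (\<Union>C)"
    proof (rule inj_onI)
      fix a b assume "a \<in> \<Union>C" "b \<in> \<Union>C" "q a = q b"
      then obtain G where "G \<in> C" "a \<in> G" "b \<in> G"
        using C(2) unfolding subset_chain_def by blast
      then show "a = b"
        using C(2) \<open>q a = q b\<close> by (auto simp: subset_chain_def dest!: subsetD inj_onD)
    qed
    moreover have "submodule (\<Union>C) K V"
      by (rule submodule_Union_chain[OF C]) (use assms(2) in auto)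
    moreover have "P \<subseteq> \<Union>C"
      using C unfolding subset_chain_def by blast
    ultimately show "\<Union>C \<in> ?A" by blast
  qed
  then obtain G where GA: "G \<in> ?A" and maxA: "\<forall>X\<in>?A. G \<subseteq> X \<longrightarrow> X = G"
    by (rule bexE)
  from GA have G: "submodule G K V" "P \<subseteq> G" "inj_on q G"
    by simp_all
  have max: "X = G" if "submodule X K V" "G \<subseteq> X" "inj_on q X" for X
    using bspec[OF maxA, of X] that G(2) by simp
  interpret G: submodule G K V by fact
  have G_simps [simp]: "g \<in> G \<Longrightarrow> g \<in> carrier V" "\<zero>\<^bsub>V\<^esub> \<in> G"
    "g \<in> G \<Longrightarrow> \<ominus>\<^bsub>V\<^esub> g \<in> G" "\<lbrakk>g \<in> G; h \<in> G\<rbrakk> \<Longrightarrow> g \<oplus>\<^bsub>V\<^esub> h \<in> G"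
    "\<lbrakk>c \<in> carrier K; g \<in> G\<rbrakk> \<Longrightarrow> c \<odot>\<^bsub>V\<^esub> g \<in> G" for g h c
    using V.submoduleE[OF G(1)] G.subset G.one_closed by auto
  have surj: "carrier W \<subseteq> q ` G"
  proof
    fix w assume "w \<in> carrier W"
    then obtain v where v: "v \<in> carrier V" "w = q v" using q(2) by blast
    show "w \<in> q ` G"
    proof (rule ccontr)
      assume w: "w \<notin> q ` G"
      \<comment> \<open>Adjoining to G the line of a preimage v of the missed vector w gives a
        larger candidate.\<close>
      define X where "X = {g \<oplus>\<^bsub>V\<^esub> c \<odot>\<^bsub>V\<^esub> v | g c. g \<in> G \<and> c \<in> carrier K}"
      have XI: "g \<oplus>\<^bsub>V\<^esub> c \<odot>\<^bsub>V\<^esub> v \<in> X" if "g \<in> G" "c \<in> carrier K" for g c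
        using that by (auto simp: X_def)
      have "submodule X K V"
      proof (rule V.submoduleI)
        show "X \<subseteq> carrier V" using v by (auto simp: X_def)
        show "\<zero>\<^bsub>V\<^esub> \<in> X" using XI[of "\<zero>\<^bsub>V\<^esub>" \<zero>] v by simp
        show "\<ominus>\<^bsub>V\<^esub> a \<in> X" if "a \<in> X" for a
        proof -
          from that obtain g c where a: "a = g \<oplus>\<^bsub>V\<^esub> c \<odot>\<^bsub>V\<^esub> v" "g \<in> G" "c \<in> carrier K"
            by (auto simp: X_def)
          from a have "\<ominus>\<^bsub>V\<^esub> a = \<ominus>\<^bsub>V\<^esub> g \<oplus>\<^bsub>V\<^esub> (\<ominus> c) \<odot>\<^bsub>V\<^esub> v"
            using v by (simp add: V.minus_add V.smult_l_minus)
          then show ?thesis using XI[of "\<ominus>\<^bsub>V\<^esub> g" "\<ominus> c"] a by simp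
        qed
        show "a \<oplus>\<^bsub>V\<^esub> b \<in> X" if "a \<in> X" "b \<in> X" for a b
        proof -
          from that obtain g c h e where a: "a = g \<oplus>\<^bsub>V\<^esub> c \<odot>\<^bsub>V\<^esub> v" "g \<in> G" "c \<in> carrier K"
            "b = h \<oplus>\<^bsub>V\<^esub> e \<odot>\<^bsub>V\<^esub> v" "h \<in> G" "e \<in> carrier K"
            by (auto simp: X_def)
          then have "a \<oplus>\<^bsub>V\<^esub> b = (g \<oplus>\<^bsub>V\<^esub> h) \<oplus>\<^bsub>V\<^esub> (c \<oplus> e) \<odot>\<^bsub>V\<^esub> v"
            using v by (simp add: V.a_ac V.smult_l_distr)
          then show ?thesis using XI[of "g \<oplus>\<^bsub>V\<^esub> h" "c \<oplus> e"] a by simp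
        qed
        show "e \<odot>\<^bsub>V\<^esub> a \<in> X" if "e \<in> carrier K" "a \<in> X" for e a
        proof -
          from that obtain g c where a: "a = g \<oplus>\<^bsub>V\<^esub> c \<odot>\<^bsub>V\<^esub> v" "g \<in> G" "c \<in> carrier K"
            by (auto simp: X_def)
          then have "e \<odot>\<^bsub>V\<^esub> a = e \<odot>\<^bsub>V\<^esub> g \<oplus>\<^bsub>V\<^esub> (e \<otimes> c) \<odot>\<^bsub>V\<^esub> v"
            using v that by (simp add: V.smult_r_distr V.smult_assoc1)
          then show ?thesis using XI[of "e \<odot>\<^bsub>V\<^esub> g" "e \<otimes> c"] a that by simp
        qed
      qed
      moreover have "G \<subseteq> X"
      proof
        fix g assume "g \<in> G" then show "g \<in> X" using XI[of g \<zero>] v by simp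
      qed
      moreover have "inj_on q X"
      proof (rule inj_on_submodule)
        fix a assume "a \<in> X" and qa: "q a = \<zero>\<^bsub>W\<^esub>"
        then obtain g c where a: "a = g \<oplus>\<^bsub>V\<^esub> c \<odot>\<^bsub>V\<^esub> v" "g \<in> G" "c \<in> carrier K"
          by (auto simp: X_def)
        have W: "q g \<in> carrier W" "w \<in> carrier W"
          using a v by (simp_all add: q_simps)
        have eq: "q g \<oplus>\<^bsub>W\<^esub> c \<odot>\<^bsub>W\<^esub> w = \<zero>\<^bsub>W\<^esub>"
          using qa a v by (simp add: q_simps)
        \<comment> \<open>If c were nonzero, dividing the relation q g + c w = 0 by c would exhibit
          w in q(G); here the field property of K enters.\<close>
        have "c = \<zero>"
        proof (rule ccontr)
          assume "c \<noteq> \<zero>"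
          then have c: "c \<in> Units K"
            using a by (simp add: K.field_Units)
          have "c \<odot>\<^bsub>W\<^esub> w = q (\<ominus>\<^bsub>V\<^esub> g)"
            using eq a W W.minus_equality[of "c \<odot>\<^bsub>W\<^esub> w" "q g"]
            by (simp add: q_simps W.a_comm)
          then have "inv c \<odot>\<^bsub>W\<^esub> (c \<odot>\<^bsub>W\<^esub> w) = q (inv c \<odot>\<^bsub>V\<^esub> (\<ominus>\<^bsub>V\<^esub> g))"
            using a c by (simp add: q_simps)
          then have "w = q (inv c \<odot>\<^bsub>V\<^esub> (\<ominus>\<^bsub>V\<^esub> g))"
            using W a c by (simp add: W.smult_assoc1[symmetric])
          then show False using w c a by simp
        qed
        with eq v W a have "q g = q \<zero>\<^bsub>V\<^esub>" by (simp add: q_simps)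
        then have "g = \<zero>\<^bsub>V\<^esub>" using a(2) G(3) by (simp add: inj_on_def)
        then show "a = \<zero>\<^bsub>V\<^esub>" using a v \<open>c = \<zero>\<close> by simp
      qed fact
      ultimately have "X = G" using max by blast
      then have "v \<in> G" using XI[of "\<zero>\<^bsub>V\<^esub>" \<one>] v by simp
      then show False using w v by blast
    qed
  qed
  define s where "s = inv_into G q"
  have s: "s w \<in> G" "q (s w) = w" if "w \<in> carrier W" for w
    using surj that by (auto simp: s_def inv_into_into f_inv_into_f)
  \<comment> \<open>Elements of G are recognized by their images, so linearity of the inverse
    follows from that of q.\<close>
  have s_eqI: "s w = g" if "g \<in> G" "q g = w" for g w
    using that G(3) by (auto simp: s_def)
  have "s \<in> lin_hom K W V"
    by (rule lin_homI) (auto simp: s q_simps intro!: s_eqI)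
  then show ?thesis
    using s s_eqI G(2) by blast
qed

section \<open>Well-defined operations on cosets and quotient modules\<close>

lemma UN_eq_constI: "\<lbrakk>a \<in> A; \<And>b. b \<in> A \<Longrightarrow> f b = c\<rbrakk> \<Longrightarrow> (\<Union>b\<in>A. f b) = c"
  by blast

text \<open>Together with \<open>UN_eq_constI\<close> this is the form of well-definedness used
  throughout: operations on cosets are unions over all representatives, and maps out of quotients
  are \<open>the_elem\<close> of an image. Both collapse once the value is constant and a
  representative exists.\<close>

lemma the_elem_image_eqI:
  assumes "a \<in> A" "\<And>b. b \<in> A \<Longrightarrow> f b = c"
  shows "the_elem (f ` A) = c"
proof -
  have "f ` A = {c}" using assms by blast
  then show ?thesis by simp
qed

text \<open>Cosets are formed with the addition of V alone, so shrinking the carrier selects cosets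
  without changing the operations. Thus \<open>H1\<close> and \<open>H2\<close>, whose carriers are
  cut down to \<open>Der\<close> and \<open>Z2\<close>, are computed in the quotient of the module
  of all functions.\<close>

lemma quot_module_carrier_update:
  "quot_module (V\<lparr>carrier := Z\<rparr>) W = (quot_module V W)\<lparr>carrier := (\<lambda>v. W +>\<^bsub>V\<^esub> v) ` Z\<rparr>"
  by (auto simp: quot_module_def A_RCOSETS_def' set_add_defs a_r_coset_def' fun_eq_iff)

lemma a_r_coset_carrier_update [simp]: "a_r_coset (V\<lparr>carrier := Z\<rparr>) = a_r_coset V"
  by (intro ext) (simp add: a_r_coset_def')

text \<open>One setting serves four quotients: g by h, 2-cochains by \<open>B2\<close>, functions on
  h by inner derivations, and the normalizer by the graph of a derivation.\<close>

locale module_quotient = V: module K V + submodule W K V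
  for K (structure) and V :: "('k, 'v, 'd) module_scheme" and W
begin

sublocale abelian_subgroup W V
  by (intro abelian_subgroupI3 additive_subgroupI subgroup_axioms V.abelian_group_axioms)

lemma coset_eq_mem_iff:
  "\<lbrakk>a \<in> carrier V; b \<in> carrier V\<rbrakk> \<Longrightarrow> W +>\<^bsub>V\<^esub> a = W +>\<^bsub>V\<^esub> b \<longleftrightarrow> a \<in> W +>\<^bsub>V\<^esub> b"
  using a_rcos_self a_repr_independence' by blast

lemma coset_eq_iff:
  "\<lbrakk>a \<in> carrier V; b \<in> carrier V\<rbrakk> \<Longrightarrow> W +>\<^bsub>V\<^esub> a = W +>\<^bsub>V\<^esub> b \<longleftrightarrow> a \<ominus>\<^bsub>V\<^esub> b \<in> W"
  using a_rcos_module[of b a] coset_eq_mem_iff[of a b] by (simp add: a_minus_def)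

lemma coset_self: "a \<in> carrier V \<Longrightarrow> a \<in> W +>\<^bsub>V\<^esub> a"
  by (rule a_rcos_self)

lemma coset_eq: "\<lbrakk>a \<in> carrier V; b \<in> W +>\<^bsub>V\<^esub> a\<rbrakk> \<Longrightarrow> W +>\<^bsub>V\<^esub> b = W +>\<^bsub>V\<^esub> a"
  using a_repr_independence' by blast

lemma coset_subset: "a \<in> carrier V \<Longrightarrow> W +>\<^bsub>V\<^esub> a \<subseteq> carrier V"
  by (simp add: V.a_r_coset_subset_G a_subset)

lemma coset_diff: "\<lbrakk>a \<in> carrier V; b \<in> W +>\<^bsub>V\<^esub> a\<rbrakk> \<Longrightarrow> b \<ominus>\<^bsub>V\<^esub> a \<in> W"
  using coset_eq_iff[of b a] coset_eq[of a b] coset_subset[of a] by blast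

lemma coset_eq_self_iff: "a \<in> carrier V \<Longrightarrow> W +>\<^bsub>V\<^esub> a = W \<longleftrightarrow> a \<in> W"
  using V.a_coset_join1 V.a_coset_join2 a_subgroup by blast

lemma carrier_quot: "carrier (quot_module V W) = (\<lambda>v. W +>\<^bsub>V\<^esub> v) ` carrier V"
  by (auto simp: quot_module_def A_RCOSETS_def')

lemma add_quot:
  "\<lbrakk>a \<in> carrier V; b \<in> carrier V\<rbrakk> \<Longrightarrow>
    (W +>\<^bsub>V\<^esub> a) \<oplus>\<^bsub>quot_module V W\<^esub> (W +>\<^bsub>V\<^esub> b) = W +>\<^bsub>V\<^esub> (a \<oplus>\<^bsub>V\<^esub> b)"
  by (simp add: quot_module_def a_rcos_sum)

lemma smult_quot:
  assumes "c \<in> carrier K" "a \<in> carrier V"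
  shows "c \<odot>\<^bsub>quot_module V W\<^esub> (W +>\<^bsub>V\<^esub> a) = W +>\<^bsub>V\<^esub> (c \<odot>\<^bsub>V\<^esub> a)"
proof -
  have *: "W +>\<^bsub>V\<^esub> (c \<odot>\<^bsub>V\<^esub> b) = W +>\<^bsub>V\<^esub> (c \<odot>\<^bsub>V\<^esub> a)" if b: "b \<in> W +>\<^bsub>V\<^esub> a" for b
  proof -
    have "b \<in> carrier V" using b assms coset_subset by blast
    then have "c \<odot>\<^bsub>V\<^esub> b \<ominus>\<^bsub>V\<^esub> c \<odot>\<^bsub>V\<^esub> a = c \<odot>\<^bsub>V\<^esub> (b \<ominus>\<^bsub>V\<^esub> a)"
      using assms by (simp add: a_minus_def V.smult_r_distr V.smult_r_minus)
    then have "c \<odot>\<^bsub>V\<^esub> b \<ominus>\<^bsub>V\<^esub> c \<odot>\<^bsub>V\<^esub> a \<in> W"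
      using smult_closed[OF assms(1) coset_diff[OF assms(2) b]] by metis
    then show ?thesis
      by (intro iffD2[OF coset_eq_iff] V.smult_closed assms \<open>b \<in> carrier V\<close>)
  qed
  have "(\<Union>b\<in>W +>\<^bsub>V\<^esub> a. W +>\<^bsub>V\<^esub> (c \<odot>\<^bsub>V\<^esub> b)) = W +>\<^bsub>V\<^esub> (c \<odot>\<^bsub>V\<^esub> a)"
    by (rule UN_eq_constI[OF coset_self[OF assms(2)] *])
  then show ?thesis
    by (simp add: quot_module_def)
qed

lemma zero_quot: "\<zero>\<^bsub>quot_module V W\<^esub> = W"
  by (simp add: quot_module_def)

lemma zero_coset: "W +>\<^bsub>V\<^esub> \<zero>\<^bsub>V\<^esub> = W"
  by (simp add: a_subset)

sublocale quot: module K "quot_module V W"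
proof (rule moduleI)
  show "abelian_group (quot_module V W)"
  proof (rule abelian_groupI)
    fix X assume "X \<in> carrier (quot_module V W)"
    then obtain a where "a \<in> carrier V" "X = W +>\<^bsub>V\<^esub> a" by (auto simp: carrier_quot)
    then show "\<exists>Y\<in>carrier (quot_module V W). Y \<oplus>\<^bsub>quot_module V W\<^esub> X = \<zero>\<^bsub>quot_module V W\<^esub>"
      by (intro bexI[of _ "W +>\<^bsub>V\<^esub> (\<ominus>\<^bsub>V\<^esub> a)"])
        (auto simp: carrier_quot add_quot zero_quot V.l_neg zero_coset)
  next
    show "\<zero>\<^bsub>quot_module V W\<^esub> \<in> carrier (quot_module V W)"
      using zero_coset by (force simp: carrier_quot zero_quot)
    show "\<zero>\<^bsub>quot_module V W\<^esub> \<oplus>\<^bsub>quot_module V W\<^esub> X = X" if "X \<in> carrier (quot_module V W)" for X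
      using that add_quot[of "\<zero>\<^bsub>V\<^esub>"] by (auto simp: carrier_quot zero_coset zero_quot)
  qed (auto simp: carrier_quot add_quot V.a_ac)
qed (auto simp: carrier_quot add_quot smult_quot V.smult_l_distr V.smult_r_distr V.smult_assoc1
    intro: V.cring_axioms V.is_cring)

end

section \<open>Modules of functions; criteria for modules and submodules\<close>

lemma (in module) module_fun_module: "module R (fun_module S M)"
proof (rule moduleI)
  show "abelian_group (fun_module S M)"
  proof (rule abelian_groupI)
    fix f assume f: "f \<in> carrier (fun_module S M)"
    then have "(\<lambda>s\<in>S. \<ominus>\<^bsub>M\<^esub> f s) \<in> carrier (fun_module S M)"
      "(\<lambda>s\<in>S. \<ominus>\<^bsub>M\<^esub> f s) \<oplus>\<^bsub>fun_module S M\<^esub> f = \<zero>\<^bsub>fun_module S M\<^esub>"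
      by (auto simp: fun_module_def M.l_neg simp: PiE_mem[where T = "\<lambda>_. carrier M"] intro!: restrict_ext)
    then show "\<exists>g\<in>carrier (fun_module S M). g \<oplus>\<^bsub>fun_module S M\<^esub> f = \<zero>\<^bsub>fun_module S M\<^esub>"
      by blast
  next
    show "f \<oplus>\<^bsub>fun_module S M\<^esub> g = g \<oplus>\<^bsub>fun_module S M\<^esub> f"
      if "f \<in> carrier (fun_module S M)" "g \<in> carrier (fun_module S M)" for f g
      using that by (auto simp: fun_module_def M.a_comm simp: PiE_mem[where T = "\<lambda>_. carrier M"] intro!: restrict_ext)
    show "f \<oplus>\<^bsub>fun_module S M\<^esub> g \<oplus>\<^bsub>fun_module S M\<^esub> h = f \<oplus>\<^bsub>fun_module S M\<^esub> (g \<oplus>\<^bsub>fun_module S M\<^esub> h)"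
      if "f \<in> carrier (fun_module S M)" "g \<in> carrier (fun_module S M)" "h \<in> carrier (fun_module S M)" for f g h
      using that by (auto simp: fun_module_def M.a_assoc simp: PiE_mem[where T = "\<lambda>_. carrier M"] intro!: restrict_ext)
    show "\<zero>\<^bsub>fun_module S M\<^esub> \<oplus>\<^bsub>fun_module S M\<^esub> f = f" if "f \<in> carrier (fun_module S M)" for f
      by (intro PiE_ext[of _ S "\<lambda>_. carrier M"]) (use that in \<open>auto simp: fun_module_def PiE_mem[where T = "\<lambda>_. carrier M"]\<close>)
  qed (auto simp: fun_module_def simp: PiE_mem[where T = "\<lambda>_. carrier M"])
  show "\<one> \<odot>\<^bsub>fun_module S M\<^esub> f = f" if "f \<in> carrier (fun_module S M)" for f
      by (intro PiE_ext[of _ S "\<lambda>_. carrier M"]) (use that in \<open>auto simp: fun_module_def PiE_mem[where T = "\<lambda>_. carrier M"]\<close>)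
qed (auto simp: fun_module_def smult_l_distr smult_r_distr smult_assoc1 is_cring
    simp: PiE_mem[where T = "\<lambda>_. carrier M"] intro!: restrict_ext)

text \<open>The module axioms for V involve only these four fields, so they pass between records of
  different types, such as \<open>quot_module\<close> and \<open>quot_lie\<close>.\<close>

lemma module_cong:
  assumes "module K V" "carrier V' = carrier V" "add V' = add V" "zero V' = zero V" "smult V' = smult V"
  shows "module K V'"
proof -
  interpret module K V by fact
  show ?thesis
  proof (rule moduleI)
    show "abelian_group V'"
      by (rule abelian_groupI) (auto simp: assms M.a_ac intro: M.l_neg M.a_inv_closed)
  qed (auto simp: assms smult_l_distr smult_r_distr smult_assoc1 is_cring)
qed

lemma (in module) smult_r_diff:
  "\<lbrakk>a \<in> carrier R; x \<in> carrier M; y \<in> carrier M\<rbrakk> \<Longrightarrow>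
    a \<odot>\<^bsub>M\<^esub> (x \<ominus>\<^bsub>M\<^esub> y) = a \<odot>\<^bsub>M\<^esub> x \<ominus>\<^bsub>M\<^esub> a \<odot>\<^bsub>M\<^esub> y"
  by (simp add: a_minus_def smult_r_distr smult_r_minus)

lemma (in module) submoduleI_smult:
  assumes "B \<subseteq> carrier M" "\<zero>\<^bsub>M\<^esub> \<in> B"
    "\<And>a b. \<lbrakk>a \<in> B; b \<in> B\<rbrakk> \<Longrightarrow> a \<oplus>\<^bsub>M\<^esub> b \<in> B"
    "\<And>c a. \<lbrakk>c \<in> carrier R; a \<in> B\<rbrakk> \<Longrightarrow> c \<odot>\<^bsub>M\<^esub> a \<in> B"
  shows "submodule B R M"
proof (rule submoduleI)
  show "\<ominus>\<^bsub>M\<^esub> a \<in> B" if "a \<in> B" for a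
  proof -
    \<comment> \<open>The negative is the multiple by minus one, so closure under scalars covers
      it.\<close>
    have "(\<ominus> \<one>) \<odot>\<^bsub>M\<^esub> a = \<ominus>\<^bsub>M\<^esub> a"
      using that assms(1) by (subst smult_l_minus) auto
    then show ?thesis
      using assms(4)[of "\<ominus> \<one>" a] that by simp
  qed
qed (use assms in auto)

section \<open>Cochains\<close>

text \<open>The Chevalley-Eilenberg differential from 1-cochains to 2-cochains; its kernel among
  linear maps consists of those that satisfy the derivation rule.\<close>

definition coboundary :: "('k, 'g, 'd) lie_algebra_scheme \<Rightarrow> ('k, 'g, 'n, 'e) lie_module_scheme \<Rightarrow>
    ('g \<Rightarrow> 'n) \<Rightarrow> ('g \<times> 'g \<Rightarrow> 'n)" where
  "coboundary A N \<phi> = (\<lambda>(x, y)\<in>carrier A \<times> carrier A.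
     (x \<rhd>\<^bsub>N\<^esub> \<phi> y) \<ominus>\<^bsub>N\<^esub> (y \<rhd>\<^bsub>N\<^esub> \<phi> x) \<ominus>\<^bsub>N\<^esub> \<phi> \<lbrace>x, y\<rbrace>\<^bsub>A\<^esub>)"

lemma B2_eq: "B2 K A N = coboundary A N ` lin_hom K A N"
  by (simp add: B2_def coboundary_def[abs_def])

lemma coboundary_apply:
  "\<lbrakk>x \<in> carrier A; y \<in> carrier A\<rbrakk> \<Longrightarrow> coboundary A N \<phi> (x, y) =
     (x \<rhd>\<^bsub>N\<^esub> \<phi> y) \<ominus>\<^bsub>N\<^esub> (y \<rhd>\<^bsub>N\<^esub> \<phi> x) \<ominus>\<^bsub>N\<^esub> \<phi> \<lbrace>x, y\<rbrace>\<^bsub>A\<^esub>"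
  by (simp add: coboundary_def)

context lie_algebra
begin

lemma bracket_left_hom: "y \<in> carrier L \<Longrightarrow> (\<lambda>x. \<lbrace>x, y\<rbrace>) \<in> lin_hom K L L"
  by (intro lin_homI bracket_closed bracket_add_left bracket_smult_left)

lemma bracket_right_hom: "x \<in> carrier L \<Longrightarrow> (\<lambda>y. \<lbrace>x, y\<rbrace>) \<in> lin_hom K L L"
  by (intro lin_homI bracket_closed bracket_add_right bracket_smult_right)

lemma bracket_minus_left:
  "\<lbrakk>x \<in> carrier L; y \<in> carrier L; z \<in> carrier L\<rbrakk> \<Longrightarrow> \<lbrace>x \<ominus> y, z\<rbrace> = \<lbrace>x, z\<rbrace> \<ominus> \<lbrace>y, z\<rbrace>"
  by (rule lin_hom_minus[OF M.abelian_group_axioms M.abelian_group_axioms bracket_left_hom])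

lemma bracket_minus_right:
  "\<lbrakk>x \<in> carrier L; y \<in> carrier L; z \<in> carrier L\<rbrakk> \<Longrightarrow> \<lbrace>x, y \<ominus> z\<rbrace> = \<lbrace>x, y\<rbrace> \<ominus> \<lbrace>x, z\<rbrace>"
  by (rule lin_hom_minus[OF M.abelian_group_axioms M.abelian_group_axioms bracket_right_hom])

lemma bracket_zero_left: "y \<in> carrier L \<Longrightarrow> \<lbrace>\<zero>, y\<rbrace> = \<zero>"
  by (rule lin_hom_zero[OF M.abelian_group_axioms M.abelian_group_axioms bracket_left_hom])

text \<open>Polarization: expand [x + y, x + y] = 0.\<close>

lemma bracket_anticomm:
  assumes "x \<in> carrier L" "y \<in> carrier L"
  shows "\<lbrace>x, y\<rbrace> = \<ominus> \<lbrace>y, x\<rbrace>"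
proof (rule M.minus_equality[symmetric])
  have "\<zero> = \<lbrace>x \<oplus> y, x \<oplus> y\<rbrace>"
    using assms by (simp add: bracket_alternating)
  also have "\<dots> = \<lbrace>x, x\<rbrace> \<oplus> \<lbrace>y, x\<rbrace> \<oplus> (\<lbrace>x, y\<rbrace> \<oplus> \<lbrace>y, y\<rbrace>)"
    using assms by (subst bracket_add_right) (simp_all add: bracket_add_left)
  also have "\<dots> = \<lbrace>x, y\<rbrace> \<oplus> \<lbrace>y, x\<rbrace>"
    using assms by (simp add: bracket_alternating bracket_closed M.a_comm)
  finally show "\<lbrace>x, y\<rbrace> \<oplus> \<lbrace>y, x\<rbrace> = \<zero>" by simp
qed (use assms in \<open>simp_all add: bracket_closed\<close>)

end

context lie_module
begin

lemma act_left_hom: "m \<in> carrier M \<Longrightarrow> (\<lambda>x. x \<rhd>\<^bsub>M\<^esub> m) \<in> lin_hom K L M"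
  by (intro lin_homI act_closed act_add_left act_smult_left)

lemma act_right_hom: "x \<in> carrier L \<Longrightarrow> (\<lambda>m. x \<rhd>\<^bsub>M\<^esub> m) \<in> lin_hom K M M"
  by (intro lin_homI act_closed act_add_right act_smult_right)

lemma act_zero_left: "m \<in> carrier M \<Longrightarrow> \<zero>\<^bsub>L\<^esub> \<rhd>\<^bsub>M\<^esub> m = \<zero>\<^bsub>M\<^esub>"
  by (rule lin_hom_zero[OF L.M.abelian_group_axioms M.abelian_group_axioms act_left_hom])

lemma act_zero_right: "x \<in> carrier L \<Longrightarrow> x \<rhd>\<^bsub>M\<^esub> \<zero>\<^bsub>M\<^esub> = \<zero>\<^bsub>M\<^esub>"
  by (rule lin_hom_zero[OF M.abelian_group_axioms M.abelian_group_axioms act_right_hom])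

lemma act_minus_left:
  "\<lbrakk>x \<in> carrier L; y \<in> carrier L; m \<in> carrier M\<rbrakk> \<Longrightarrow>
    (x \<ominus>\<^bsub>L\<^esub> y) \<rhd>\<^bsub>M\<^esub> m = (x \<rhd>\<^bsub>M\<^esub> m) \<ominus>\<^bsub>M\<^esub> (y \<rhd>\<^bsub>M\<^esub> m)"
  by (rule lin_hom_minus[OF L.M.abelian_group_axioms M.abelian_group_axioms act_left_hom])

lemma act_minus_right:
  "\<lbrakk>x \<in> carrier L; m \<in> carrier M; n \<in> carrier M\<rbrakk> \<Longrightarrow>
    x \<rhd>\<^bsub>M\<^esub> (m \<ominus>\<^bsub>M\<^esub> n) = (x \<rhd>\<^bsub>M\<^esub> m) \<ominus>\<^bsub>M\<^esub> (x \<rhd>\<^bsub>M\<^esub> n)"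
  by (rule lin_hom_minus[OF M.abelian_group_axioms M.abelian_group_axioms act_right_hom])

lemma coboundary_PiE:
  "\<phi> \<in> lin_hom K L M \<Longrightarrow> coboundary L M \<phi> \<in> carrier L \<times> carrier L \<rightarrow>\<^sub>E carrier M"
  by (auto simp: coboundary_def lin_hom_closed act_closed bracket_closed)

lemma lin_hom_add_fun:
  assumes "\<phi> \<in> lin_hom K L M" "\<psi> \<in> lin_hom K L M"
  shows "(\<lambda>x. \<phi> x \<oplus>\<^bsub>M\<^esub> \<psi> x) \<in> lin_hom K L M"
  using assms
  by (intro lin_homI)
    (simp_all add: lin_hom_closed lin_hom_add[OF assms(1)] lin_hom_add[OF assms(2)]
      lin_hom_smult[OF assms(1)] lin_hom_smult[OF assms(2)] M.smult_r_distr M.a_ac)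

lemma lin_hom_smult_fun:
  assumes "c \<in> carrier K" "\<phi> \<in> lin_hom K L M"
  shows "(\<lambda>x. c \<odot>\<^bsub>M\<^esub> \<phi> x) \<in> lin_hom K L M"
  using assms
  by (intro lin_homI)
    (simp_all add: lin_hom_closed lin_hom_add[OF assms(2)]
      lin_hom_smult[OF assms(2)] M.smult_r_distr M.smult_assoc1[symmetric] m_comm)

lemma coboundary_add:
  assumes "\<phi> \<in> lin_hom K L M" "\<psi> \<in> lin_hom K L M"
  shows "coboundary L M (\<lambda>x. \<phi> x \<oplus>\<^bsub>M\<^esub> \<psi> x) =
    coboundary L M \<phi> \<oplus>\<^bsub>fun_module (carrier L \<times> carrier L) M\<^esub> coboundary L M \<psi>"
  using assms unfolding coboundary_def fun_module_def
  by (auto intro!: restrict_ext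
      simp: lin_hom_closed act_closed bracket_closed act_add_right M.minus_simps)

lemma coboundary_smult:
  assumes "c \<in> carrier K" "\<phi> \<in> lin_hom K L M"
  shows "coboundary L M (\<lambda>x. c \<odot>\<^bsub>M\<^esub> \<phi> x) =
    c \<odot>\<^bsub>fun_module (carrier L \<times> carrier L) M\<^esub> coboundary L M \<phi>"
  using assms unfolding coboundary_def fun_module_def
  by (auto intro!: restrict_ext
      simp: lin_hom_closed act_closed bracket_closed act_smult_right M.smult_r_diff)

lemma zero_lin_hom: "(\<lambda>x. \<zero>\<^bsub>M\<^esub>) \<in> lin_hom K L M"
  by (rule lin_homI) auto

lemma coboundary_zero:
  "coboundary L M (\<lambda>x. \<zero>\<^bsub>M\<^esub>) = \<zero>\<^bsub>fun_module (carrier L \<times> carrier L) M\<^esub>"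
  by (auto simp: coboundary_def fun_module_def act_zero_right M.minus_simps intro!: restrict_ext)

lemma submodule_B2: "submodule (B2 K L M) K (fun_module (carrier L \<times> carrier L) M)"
proof (rule module.submoduleI_smult[OF M.module_fun_module])
  let ?F = "fun_module (carrier L \<times> carrier L) M"
  show "B2 K L M \<subseteq> carrier ?F"
    using coboundary_PiE by (auto simp: B2_eq fun_module_def)
  show "\<zero>\<^bsub>?F\<^esub> \<in> B2 K L M"
    unfolding B2_eq coboundary_zero[symmetric] by (intro imageI zero_lin_hom)
  show "a \<oplus>\<^bsub>?F\<^esub> b \<in> B2 K L M" if "a \<in> B2 K L M" "b \<in> B2 K L M" for a b
    using that by (auto simp: B2_eq coboundary_add[symmetric] lin_hom_add_fun)
  show "c \<odot>\<^bsub>?F\<^esub> a \<in> B2 K L M" if "c \<in> carrier K" "a \<in> B2 K L M" for c a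
    using that by (auto simp: B2_eq coboundary_smult[symmetric] lin_hom_smult_fun)
qed

sublocale cochains: module_quotient K "fun_module (carrier L \<times> carrier L) M" "B2 K L M"
  by (intro module_quotient.intro submodule_B2 M.module_fun_module)

lemma carrier_H2: "carrier (H2 K L M) = H2_class K L M ` Z2 K L M"
  by (simp add: H2_def quot_module_carrier_update H2_class_def)

lemma zero_H2: "\<zero>\<^bsub>H2 K L M\<^esub> = B2 K L M"
  by (simp add: H2_def quot_module_carrier_update cochains.zero_quot)

lemma add_H2:
  assumes "f \<in> carrier L \<times> carrier L \<rightarrow>\<^sub>E carrier M" "g \<in> carrier L \<times> carrier L \<rightarrow>\<^sub>E carrier M"
  shows "H2_class K L M f \<oplus>\<^bsub>H2 K L M\<^esub> H2_class K L M g =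
    H2_class K L M (f \<oplus>\<^bsub>fun_module (carrier L \<times> carrier L) M\<^esub> g)"
  using cochains.add_quot[of f g] assms
  by (simp add: H2_def quot_module_carrier_update H2_class_def) (simp add: fun_module_def)

lemma smult_H2:
  assumes "c \<in> carrier K" "f \<in> carrier L \<times> carrier L \<rightarrow>\<^sub>E carrier M"
  shows "c \<odot>\<^bsub>H2 K L M\<^esub> H2_class K L M f =
    H2_class K L M (c \<odot>\<^bsub>fun_module (carrier L \<times> carrier L) M\<^esub> f)"
  using cochains.smult_quot[of c f] assms
  by (simp add: H2_def quot_module_carrier_update H2_class_def) (simp add: fun_module_def)

lemma H2_class_eq_add:
  assumes "f \<in> carrier L \<times> carrier L \<rightarrow>\<^sub>E carrier M" "b \<in> B2 K L M"
  shows "H2_class K L M (b \<oplus>\<^bsub>fun_module (carrier L \<times> carrier L) M\<^esub> f) = H2_class K L M f"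
proof -
  have "b \<oplus>\<^bsub>fun_module (carrier L \<times> carrier L) M\<^esub> f
      \<in> B2 K L M +>\<^bsub>fun_module (carrier L \<times> carrier L) M\<^esub> f"
    using assms(2) by (auto simp: a_r_coset_def')
  then show ?thesis
    using assms(1) unfolding H2_class_def by (intro cochains.coset_eq) (simp add: fun_module_def)
qed

lemma H2_class_eq_zero_iff:
  assumes "f \<in> carrier L \<times> carrier L \<rightarrow>\<^sub>E carrier M"
  shows "H2_class K L M f = B2 K L M \<longleftrightarrow> f \<in> B2 K L M"
  using cochains.coset_eq_self_iff[of f] assms by (simp add: H2_class_def fun_module_def)

lemma mem_H2_class_iff:
  "g \<in> H2_class K L M f \<longleftrightarrow>
    (\<exists>b\<in>B2 K L M. g = b \<oplus>\<^bsub>fun_module (carrier L \<times> carrier L) M\<^esub> f)"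
  by (auto simp: H2_class_def a_r_coset_def')

text \<open>The differential squares to zero: the terms x . (y . \<phi> z) match through
  \<open>act_bracket\<close>, the terms x . \<phi> [y, z] occur on both sides, and the values of
  \<phi> on double brackets sum to zero by the Jacobi identity.\<close>

lemma coboundary_mem_Z2:
  assumes \<phi>: "\<phi> \<in> lin_hom K L M"
  shows "coboundary L M \<phi> \<in> Z2 K L M"
proof -
  note cl = lin_hom_closed[OF \<phi>] act_closed bracket_closed
  note \<phi>_simps = lin_hom_add[OF \<phi>] lin_hom_smult[OF \<phi>]
  have lin1: "(\<lambda>y. coboundary L M \<phi> (x, y)) \<in> lin_hom K L M" if "x \<in> carrier L" for x
    using that
    by (intro lin_homI) (simp_all add: coboundary_apply cl \<phi>_simps act_add_left act_add_right
      bracket_add_right M.minus_simps act_smult_left act_smult_right bracket_smult_right,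
      simp_all add: cl M.smult_r_diff M.smult_r_distr M.minus_simps)
  have lin2: "(\<lambda>x. coboundary L M \<phi> (x, y)) \<in> lin_hom K L M" if "y \<in> carrier L" for y
    using that
    by (intro lin_homI) (simp_all add: coboundary_apply cl \<phi>_simps act_add_left act_add_right
      bracket_add_left M.minus_simps act_smult_left act_smult_right bracket_smult_left,
      simp_all add: cl M.smult_r_diff M.smult_r_distr M.minus_simps)
  have alt: "coboundary L M \<phi> (x, x) = \<zero>\<^bsub>M\<^esub>" if "x \<in> carrier L" for x
    using that lin_hom_zero[OF L.M.abelian_group_axioms M.abelian_group_axioms \<phi>]
    by (simp add: coboundary_apply cl bracket_alternating a_minus_def M.r_neg)
  have cocycle: "(x \<rhd>\<^bsub>M\<^esub> coboundary L M \<phi> (y, z)) \<oplus>\<^bsub>M\<^esub> (y \<rhd>\<^bsub>M\<^esub> coboundary L M \<phi> (z, x))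
        \<oplus>\<^bsub>M\<^esub> (z \<rhd>\<^bsub>M\<^esub> coboundary L M \<phi> (x, y)) =
      coboundary L M \<phi> (\<lbrace>x, y\<rbrace>\<^bsub>L\<^esub>, z) \<oplus>\<^bsub>M\<^esub> coboundary L M \<phi> (\<lbrace>y, z\<rbrace>\<^bsub>L\<^esub>, x)
        \<oplus>\<^bsub>M\<^esub> coboundary L M \<phi> (\<lbrace>z, x\<rbrace>\<^bsub>L\<^esub>, y)"
    if xyz: "x \<in> carrier L" "y \<in> carrier L" "z \<in> carrier L" for x y z
  proof -
    \<comment> \<open>The cocycle identity produces brackets nested on the left, while the Jacobi
      identity is stated for brackets nested on the right.\<close>
    have neg: "\<phi> \<lbrace>\<lbrace>x, y\<rbrace>\<^bsub>L\<^esub>, z\<rbrace>\<^bsub>L\<^esub> = \<ominus>\<^bsub>M\<^esub> \<phi> \<lbrace>z, \<lbrace>x, y\<rbrace>\<^bsub>L\<^esub>\<rbrace>\<^bsub>L\<^esub>"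
      if "x \<in> carrier L" "y \<in> carrier L" "z \<in> carrier L" for x y z
      using that bracket_anticomm[of "\<lbrace>x, y\<rbrace>\<^bsub>L\<^esub>" z]
        lin_hom_a_inv[OF L.M.abelian_group_axioms M.abelian_group_axioms \<phi>]
      by (simp add: bracket_closed)
    have "\<phi> \<lbrace>x, \<lbrace>y, z\<rbrace>\<^bsub>L\<^esub>\<rbrace>\<^bsub>L\<^esub> \<oplus>\<^bsub>M\<^esub> \<phi> \<lbrace>y, \<lbrace>z, x\<rbrace>\<^bsub>L\<^esub>\<rbrace>\<^bsub>L\<^esub> \<oplus>\<^bsub>M\<^esub> \<phi> \<lbrace>z, \<lbrace>x, y\<rbrace>\<^bsub>L\<^esub>\<rbrace>\<^bsub>L\<^esub> =
        \<phi> (\<lbrace>x, \<lbrace>y, z\<rbrace>\<^bsub>L\<^esub>\<rbrace>\<^bsub>L\<^esub> \<oplus>\<^bsub>L\<^esub> \<lbrace>y, \<lbrace>z, x\<rbrace>\<^bsub>L\<^esub>\<rbrace>\<^bsub>L\<^esub> \<oplus>\<^bsub>L\<^esub> \<lbrace>z, \<lbrace>x, y\<rbrace>\<^bsub>L\<^esub>\<rbrace>\<^bsub>L\<^esub>)"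
      using xyz by (simp add: \<phi>_simps cl)
    also have "\<dots> = \<zero>\<^bsub>M\<^esub>"
      using xyz by (simp add: jacobi lin_hom_zero[OF L.M.abelian_group_axioms M.abelian_group_axioms \<phi>])
    \<comment> \<open>Solved for one term, the Jacobi relation can be substituted, and what remains
      is a comparison of sums.\<close>
    finally have "\<phi> \<lbrace>z, \<lbrace>x, y\<rbrace>\<^bsub>L\<^esub>\<rbrace>\<^bsub>L\<^esub> =
        \<zero>\<^bsub>M\<^esub> \<ominus>\<^bsub>M\<^esub> (\<phi> \<lbrace>x, \<lbrace>y, z\<rbrace>\<^bsub>L\<^esub>\<rbrace>\<^bsub>L\<^esub> \<oplus>\<^bsub>M\<^esub> \<phi> \<lbrace>y, \<lbrace>z, x\<rbrace>\<^bsub>L\<^esub>\<rbrace>\<^bsub>L\<^esub>)"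
      using xyz by (simp add: cl M.minus_simps)
    with xyz show ?thesis
      by (simp add: coboundary_apply neg act_minus_right act_bracket cl)
        (simp add: cl M.minus_simps)
  qed
  show ?thesis
    using coboundary_PiE[OF \<phi>] lin1 lin2 alt cocycle by (simp add: Z2_def)
qed

text \<open>This is \<open>act_bracket\<close> read for the cochain x |-> x . n. It is the reason
  why changing a derivation by an inner one leaves the attached cocycle unchanged.\<close>

lemma coboundary_inner:
  assumes "n \<in> carrier M"
  shows "coboundary L M (\<lambda>x. x \<rhd>\<^bsub>M\<^esub> n) = \<zero>\<^bsub>fun_module (carrier L \<times> carrier L) M\<^esub>"
  using assms
  by (auto simp: coboundary_def fun_module_def act_bracket act_closed M.minus_simps
      intro!: restrict_ext)

end

section \<open>The quotient Lie algebra and its module of invariants\<close>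

context lie_ideal
begin

sublocale quot: module_quotient K L H
  by (intro module_quotient.intro L.module_axioms submodule_axioms)

lemma ideal_carrier: "z \<in> H \<Longrightarrow> z \<in> carrier L"
  using subset by auto

lemma ideal_zero: "\<zero> \<in> H"
  by (rule quot.zero_closed)

lemma ideal_add: "\<lbrakk>z \<in> H; w \<in> H\<rbrakk> \<Longrightarrow> z \<oplus> w \<in> H"
  by (rule quot.a_closed)

lemma ideal_inv: "z \<in> H \<Longrightarrow> \<ominus> z \<in> H"
  by (rule quot.a_inv_closed)

lemma ideal_closed_left: "\<lbrakk>z \<in> H; x \<in> carrier L\<rbrakk> \<Longrightarrow> \<lbrace>z, x\<rbrace> \<in> H"
  using bracket_anticomm[of z x] ideal_closed ideal_inv ideal_carrier by simp

lemma carrier_quot_lie: "carrier (quot_lie L H) = (\<lambda>x. H +> x) ` carrier L"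
  by (auto simp: quot_lie_def A_RCOSETS_def')

lemma quot_lie_cases:
  assumes "X \<in> carrier (quot_lie L H)"
  obtains x where "x \<in> carrier L" "X = H +> x"
  using assms by (auto simp: carrier_quot_lie)

lemma coset_mem_quot_lie: "x \<in> carrier L \<Longrightarrow> H +> x \<in> carrier (quot_lie L H)"
  by (simp add: carrier_quot_lie)

lemma quot_lie_sel:
  "carrier (quot_lie L H) = carrier (quot_module L H)" "add (quot_lie L H) = add (quot_module L H)"
  "zero (quot_lie L H) = zero (quot_module L H)" "smult (quot_lie L H) = smult (quot_module L H)"
  by (simp_all add: quot_lie_def quot_module_def)

lemma zero_quot_lie: "\<zero>\<^bsub>quot_lie L H\<^esub> = H"
  by (simp add: quot_lie_def)

lemma add_quot_lie:
  "\<lbrakk>x \<in> carrier L; y \<in> carrier L\<rbrakk> \<Longrightarrow> (H +> x) \<oplus>\<^bsub>quot_lie L H\<^esub> (H +> y) = H +> (x \<oplus> y)"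
  by (simp add: quot_lie_sel quot.add_quot)

lemma smult_quot_lie:
  "\<lbrakk>c \<in> carrier K; x \<in> carrier L\<rbrakk> \<Longrightarrow> c \<odot>\<^bsub>quot_lie L H\<^esub> (H +> x) = H +> (c \<odot> x)"
  by (simp add: quot_lie_sel quot.smult_quot)

lemma bracket_quot_lie:
  assumes xy: "x \<in> carrier L" "y \<in> carrier L"
  shows "\<lbrace>H +> x, H +> y\<rbrace>\<^bsub>quot_lie L H\<^esub> = H +> \<lbrace>x, y\<rbrace>"
proof -
  have "H +> \<lbrace>a, b\<rbrace> = H +> \<lbrace>x, y\<rbrace>" if a: "a \<in> H +> x" and b: "b \<in> H +> y" for a b
  proof -
    have ab: "a \<in> carrier L" "b \<in> carrier L"
      using a b xy quot.coset_subset by blast+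
    \<comment> \<open>The arguments are changed one at a time; each summand is a bracket with an
      element of the ideal, once on the left and once on the right.\<close>
    then have "\<lbrace>a, b\<rbrace> \<ominus> \<lbrace>x, y\<rbrace> = \<lbrace>a \<ominus> x, b\<rbrace> \<oplus> \<lbrace>x, b \<ominus> y\<rbrace>"
      using xy by (simp add: bracket_minus_left bracket_minus_right bracket_closed M.minus_simps)
    also have "\<dots> \<in> H"
      using quot.coset_diff[OF _ a] quot.coset_diff[OF _ b] xy ab
      by (intro ideal_add ideal_closed ideal_closed_left) auto
    finally show ?thesis
      using ab xy by (simp add: quot.coset_eq_iff bracket_closed)
  qed
  then have "(\<Union>a\<in>H +> x. \<Union>b\<in>H +> y. H +> \<lbrace>a, b\<rbrace>) = H +> \<lbrace>x, y\<rbrace>"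
    by (intro UN_eq_constI[OF quot.coset_self[OF xy(1)]] UN_eq_constI[OF quot.coset_self[OF xy(2)]])
  then show ?thesis
    by (simp add: quot_lie_def)
qed

lemma module_quot_lie: "module K (quot_lie L H)"
  by (rule module_cong[OF quot.quot.module_axioms]) (simp_all add: quot_lie_sel)

lemma lie_algebra_quot_lie: "lie_algebra K (quot_lie L H)"
proof (intro lie_algebra.intro lie_algebra_axioms.intro)
  show "field K" by (rule K.field_axioms)
qed (auto simp: module_quot_lie elim!: quot_lie_cases,
    auto simp: coset_mem_quot_lie add_quot_lie smult_quot_lie bracket_quot_lie zero_quot_lie
      bracket_closed bracket_add_left bracket_add_right bracket_smult_left bracket_smult_right
      bracket_alternating jacobi quot.zero_coset)

end

locale lie_ideal_module = lie_ideal H K L + lie_module K L M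
  for H and K :: "('k, 'c) ring_scheme" and L :: "('k, 'g, 'd) lie_algebra_scheme" (structure)
    and M :: "('k, 'g, 'm, 'e) lie_module_scheme" (structure)
begin

lemma annihilated_iff: "m \<in> annihilated H M \<longleftrightarrow> m \<in> carrier M \<and> (\<forall>z\<in>H. z \<rhd>\<^bsub>M\<^esub> m = \<zero>\<^bsub>M\<^esub>)"
  by (simp add: annihilated_def)

lemma annihilated_closed: "m \<in> annihilated H M \<Longrightarrow> m \<in> carrier M"
  by (simp add: annihilated_def)

text \<open>For z in h the bracket [x, z] lies in h and kills m; it acts as x . (z . m) - z . (x .
  m), whose first term vanishes as well.\<close>

lemma act_annihilated:
  assumes "x \<in> carrier L" "m \<in> annihilated H M"
  shows "x \<rhd>\<^bsub>M\<^esub> m \<in> annihilated H M"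
proof -
  have "z \<rhd>\<^bsub>M\<^esub> x \<rhd>\<^bsub>M\<^esub> m = \<zero>\<^bsub>M\<^esub>" if z: "z \<in> H" for z
  proof -
    have "\<zero>\<^bsub>M\<^esub> = \<lbrace>x, z\<rbrace>\<^bsub>L\<^esub> \<rhd>\<^bsub>M\<^esub> m"
      using assms z by (simp add: annihilated_iff ideal_closed)
    also have "\<dots> = \<zero>\<^bsub>M\<^esub> \<ominus>\<^bsub>M\<^esub> (z \<rhd>\<^bsub>M\<^esub> x \<rhd>\<^bsub>M\<^esub> m)"
      using assms z by (simp add: annihilated_iff act_bracket act_zero_right ideal_carrier)
    finally show ?thesis
      using assms z by (simp add: annihilated_iff act_closed ideal_carrier M.minus_simps)
  qed
  with assms show ?thesis
    by (simp add: annihilated_iff act_closed)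
qed

lemma submodule_annihilated: "submodule (annihilated H M) K M"
  by (rule M.submoduleI_smult)
    (auto simp: annihilated_iff act_zero_right act_add_right act_smult_right ideal_carrier)

lemma ideal_invariants_sel [simp]:
  "carrier (ideal_invariants H M) = annihilated H M" "add (ideal_invariants H M) = add M"
  "zero (ideal_invariants H M) = zero M" "smult (ideal_invariants H M) = smult M"
  by (simp_all add: ideal_invariants_def)

lemma module_ideal_invariants: "module K (ideal_invariants H M)"
  by (rule module_cong[OF submodule.submodule_is_module[OF submodule_annihilated M.module_axioms]])
    simp_all

text \<open>Negatives are chosen relative to the carrier, so subtraction in the smaller module is
  not literally that of M; uniqueness of negatives identifies the two on invariants.\<close>

lemma minus_ideal_invariants:
  assumes "m \<in> annihilated H M" "n \<in> annihilated H M"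
  shows "m \<ominus>\<^bsub>ideal_invariants H M\<^esub> n = m \<ominus>\<^bsub>M\<^esub> n"
proof -
  interpret I: module K "ideal_invariants H M" by (rule module_ideal_invariants)
  have "\<ominus>\<^bsub>ideal_invariants H M\<^esub> n = \<ominus>\<^bsub>M\<^esub> n"
    using assms I.M.a_inv_closed[of n] I.M.l_neg[of n]
    by (intro M.minus_equality[symmetric]) (simp_all add: annihilated_closed)
  then show ?thesis
    by (simp add: a_minus_def)
qed

text \<open>Representatives of a coset differ by elements of h, which kill m, so the
  \<open>the_elem\<close> in the action is a genuine value.\<close>

lemma act_ideal_invariants:
  assumes x: "x \<in> carrier L" and m: "m \<in> annihilated H M"
  shows "(H +>\<^bsub>L\<^esub> x) \<rhd>\<^bsub>ideal_invariants H M\<^esub> m = x \<rhd>\<^bsub>M\<^esub> m"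
proof -
  have "y \<rhd>\<^bsub>M\<^esub> m = x \<rhd>\<^bsub>M\<^esub> m" if y: "y \<in> H +>\<^bsub>L\<^esub> x" for y
  proof -
    have yL: "y \<in> carrier L" using y x quot.coset_subset by blast
    have "(y \<ominus>\<^bsub>L\<^esub> x) \<rhd>\<^bsub>M\<^esub> m = \<zero>\<^bsub>M\<^esub>"
      using quot.coset_diff[OF x y] m by (simp add: annihilated_iff)
    then show ?thesis
      using x yL m by (simp add: act_minus_left annihilated_closed act_closed M.minus_simps)
  qed
  from the_elem_image_eqI[OF quot.coset_self[OF x] this] show ?thesis
    by (simp add: ideal_invariants_def)
qed

lemma lie_module_ideal_invariants: "lie_module K (quot_lie L H) (ideal_invariants H M)"
proof (intro lie_module.intro lie_module_axioms.intro)
  show "lie_algebra K (quot_lie L H)" by (rule lie_algebra_quot_lie)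
  show "module K (ideal_invariants H M)" by (rule module_ideal_invariants)
qed (auto elim!: quot_lie_cases,
    auto simp: add_quot_lie smult_quot_lie bracket_quot_lie act_ideal_invariants act_annihilated
      annihilated_closed act_add_left act_add_right act_smult_left act_smult_right act_bracket
      bracket_closed minus_ideal_invariants
      submodule.smult_closed[OF submodule_annihilated]
      subgroup.m_closed[OF submodule.axioms(1)[OF submodule_annihilated], simplified])

sublocale inv: lie_module K "quot_lie L H" "ideal_invariants H M"
  by (rule lie_module_ideal_invariants)

end

context lie_module
begin

lemma Z2_lin_left: "\<lbrakk>f \<in> Z2 K L M; y \<in> carrier L\<rbrakk> \<Longrightarrow> (\<lambda>x. f (x, y)) \<in> lin_hom K L M"
  by (simp add: Z2_def)

lemma Z2_lin_right: "\<lbrakk>f \<in> Z2 K L M; x \<in> carrier L\<rbrakk> \<Longrightarrow> (\<lambda>y. f (x, y)) \<in> lin_hom K L M"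
  by (simp add: Z2_def)

lemma Z2_closed: "\<lbrakk>f \<in> Z2 K L M; x \<in> carrier L; y \<in> carrier L\<rbrakk> \<Longrightarrow> f (x, y) \<in> carrier M"
  by (auto simp: Z2_def)

lemma Z2_alternating: "\<lbrakk>f \<in> Z2 K L M; x \<in> carrier L\<rbrakk> \<Longrightarrow> f (x, x) = \<zero>\<^bsub>M\<^esub>"
  by (simp add: Z2_def)

lemma Z2_cocycle:
  "\<lbrakk>f \<in> Z2 K L M; x \<in> carrier L; y \<in> carrier L; z \<in> carrier L\<rbrakk> \<Longrightarrow>
    (x \<rhd>\<^bsub>M\<^esub> f (y, z)) \<oplus>\<^bsub>M\<^esub> (y \<rhd>\<^bsub>M\<^esub> f (z, x)) \<oplus>\<^bsub>M\<^esub> (z \<rhd>\<^bsub>M\<^esub> f (x, y)) =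
    f (\<lbrace>x, y\<rbrace>\<^bsub>L\<^esub>, z) \<oplus>\<^bsub>M\<^esub> f (\<lbrace>y, z\<rbrace>\<^bsub>L\<^esub>, x) \<oplus>\<^bsub>M\<^esub> f (\<lbrace>z, x\<rbrace>\<^bsub>L\<^esub>, y)"
  by (simp add: Z2_def)

end

section \<open>Relative cochains\<close>

context lie_ideal_module
begin

text \<open>In this form the equation says that the pair (\<phi> x, x) normalizes the graph of
  \<phi> restricted to h, compare \<open>mem_normalizer_iff\<close>. The reading as a vanishing
  coboundary is \<open>rel_cochains_iff\<close>.\<close>

definition rel_cochains :: "('g \<Rightarrow> 'm) set" where
  "rel_cochains = {\<phi> \<in> lin_hom K L M. \<forall>x\<in>carrier L. \<forall>z\<in>H.
     (x \<rhd>\<^bsub>M\<^esub> \<phi> z) \<ominus>\<^bsub>M\<^esub> (z \<rhd>\<^bsub>M\<^esub> \<phi> x) = \<phi> \<lbrace>x, z\<rbrace>\<^bsub>L\<^esub>}"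

lemma rel_cochains_lin: "\<phi> \<in> rel_cochains \<Longrightarrow> \<phi> \<in> lin_hom K L M"
  by (simp add: rel_cochains_def)

lemma rel_cochainsD:
  "\<lbrakk>\<phi> \<in> rel_cochains; x \<in> carrier L; z \<in> H\<rbrakk> \<Longrightarrow>
    (x \<rhd>\<^bsub>M\<^esub> \<phi> z) \<ominus>\<^bsub>M\<^esub> (z \<rhd>\<^bsub>M\<^esub> \<phi> x) = \<phi> \<lbrace>x, z\<rbrace>\<^bsub>L\<^esub>"
  by (simp add: rel_cochains_def)

lemma rel_cochains_iff:
  "\<phi> \<in> rel_cochains \<longleftrightarrow>
    \<phi> \<in> lin_hom K L M \<and> (\<forall>x\<in>carrier L. \<forall>z\<in>H. coboundary L M \<phi> (x, z) = \<zero>\<^bsub>M\<^esub>)"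
  by (auto simp: rel_cochains_def coboundary_apply ideal_carrier lin_hom_closed act_closed
      bracket_closed M.minus_simps)

lemma rel_cochains_add:
  assumes "\<phi> \<in> rel_cochains" "\<psi> \<in> rel_cochains"
  shows "(\<lambda>x. \<phi> x \<oplus>\<^bsub>M\<^esub> \<psi> x) \<in> rel_cochains"
  using assms
  by (auto simp: rel_cochains_iff lin_hom_add_fun coboundary_add fun_module_def ideal_carrier)

lemma rel_cochains_smult:
  assumes "c \<in> carrier K" "\<phi> \<in> rel_cochains"
  shows "(\<lambda>x. c \<odot>\<^bsub>M\<^esub> \<phi> x) \<in> rel_cochains"
  using assms
  by (auto simp: rel_cochains_iff lin_hom_smult_fun coboundary_smult fun_module_def ideal_carrier)

lemma rel_cochains_inner: "n \<in> carrier M \<Longrightarrow> (\<lambda>x. x \<rhd>\<^bsub>M\<^esub> n) \<in> rel_cochains"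
  by (auto simp: rel_cochains_iff act_left_hom coboundary_inner fun_module_def ideal_carrier)

context
  fixes \<phi> assumes \<phi>: "\<phi> \<in> rel_cochains"
begin

lemma coboundary_rel_Z2: "coboundary L M \<phi> \<in> Z2 K L M"
  by (rule coboundary_mem_Z2[OF rel_cochains_lin[OF \<phi>]])

lemma coboundary_ideal_right:
  "\<lbrakk>x \<in> carrier L; z \<in> H\<rbrakk> \<Longrightarrow> coboundary L M \<phi> (x, z) = \<zero>\<^bsub>M\<^esub>"
  using \<phi> by (simp add: rel_cochains_iff)

text \<open>Antisymmetry of the bracket turns the defining condition, which has the element of h in
  second place, into this form.\<close>

lemma coboundary_ideal_left:
  assumes "z \<in> H" "x \<in> carrier L"
  shows "coboundary L M \<phi> (z, x) = \<zero>\<^bsub>M\<^esub>"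
proof -
  have "\<phi> \<lbrace>z, x\<rbrace>\<^bsub>L\<^esub> = \<ominus>\<^bsub>M\<^esub> \<phi> \<lbrace>x, z\<rbrace>\<^bsub>L\<^esub>"
    using assms bracket_anticomm[of z x]
      lin_hom_a_inv[OF L.M.abelian_group_axioms M.abelian_group_axioms rel_cochains_lin[OF \<phi>]]
    by (simp add: bracket_closed ideal_carrier)
  then show ?thesis
    using assms rel_cochainsD[OF \<phi> assms(2,1), symmetric] lin_hom_closed[OF rel_cochains_lin[OF \<phi>]]
    by (simp add: coboundary_apply ideal_carrier act_closed M.minus_simps)
qed

text \<open>The coboundary is bilinear and vanishes as soon as one argument lies in h, so the two
  arguments can be moved within their cosets one after the other.\<close>

lemma coboundary_coset_cong:
  assumes x: "x \<in> carrier L" "x' \<in> H +>\<^bsub>L\<^esub> x" and y: "y \<in> carrier L" "y' \<in> H +>\<^bsub>L\<^esub> y"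
  shows "coboundary L M \<phi> (x', y') = coboundary L M \<phi> (x, y)"
proof -
  have xy': "x' \<in> carrier L" "y' \<in> carrier L"
    using x y quot.coset_subset by blast+
  note Z = coboundary_rel_Z2
  have "coboundary L M \<phi> (x' \<ominus>\<^bsub>L\<^esub> x, y') = \<zero>\<^bsub>M\<^esub>" "coboundary L M \<phi> (x, y' \<ominus>\<^bsub>L\<^esub> y) = \<zero>\<^bsub>M\<^esub>"
    using quot.coset_diff[OF x] quot.coset_diff[OF y] x y xy'
    by (auto intro: coboundary_ideal_left coboundary_ideal_right)
  then show ?thesis
    using lin_hom_minus[OF L.M.abelian_group_axioms M.abelian_group_axioms Z2_lin_left[OF Z, of y'], of x' x]
      lin_hom_minus[OF L.M.abelian_group_axioms M.abelian_group_axioms Z2_lin_right[OF Z, of x], of y' y]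
      x y xy' Z2_closed[OF Z]
    by (simp add: M.minus_simps)
qed

text \<open>Let f be the coboundary. In the cocycle identity for x, y and z in h, every term except
  z . f(x, y) contains a value of f with an argument in h, because [y, z] and [z, x] lie in h; all
  these terms vanish.\<close>

lemma coboundary_annihilated:
  assumes xy: "x \<in> carrier L" "y \<in> carrier L"
  shows "coboundary L M \<phi> (x, y) \<in> annihilated H M"
proof -
  note Z = coboundary_rel_Z2
  have "z \<rhd>\<^bsub>M\<^esub> coboundary L M \<phi> (x, y) = \<zero>\<^bsub>M\<^esub>" if z: "z \<in> H" for z
    using Z2_cocycle[OF Z xy ideal_carrier[OF z]] xy z Z2_closed[OF Z]
    by (simp add: coboundary_ideal_left coboundary_ideal_right bracket_closed ideal_closed
        ideal_closed_left act_zero_right act_closed ideal_carrier)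
  then show ?thesis
    using Z2_closed[OF Z] xy by (simp add: annihilated_iff)
qed

end

text \<open>The coboundary of a relative cochain only depends on cosets, so any choice of
  representatives will do.\<close>

definition tr_cocycle :: "('g \<Rightarrow> 'm) \<Rightarrow> ('g set \<times> 'g set \<Rightarrow> 'm)" where
  "tr_cocycle \<phi> = (\<lambda>(X, Y)\<in>carrier (quot_lie L H) \<times> carrier (quot_lie L H).
     coboundary L M \<phi> (SOME x. x \<in> X, SOME y. y \<in> Y))"

lemma some_coset: "x \<in> carrier L \<Longrightarrow> (SOME y. y \<in> H +>\<^bsub>L\<^esub> x) \<in> H +>\<^bsub>L\<^esub> x"
  using quot.coset_self by (rule someI)

lemma tr_cocycle_coset:
  assumes "\<phi> \<in> rel_cochains" "x \<in> carrier L" "y \<in> carrier L"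
  shows "tr_cocycle \<phi> (H +>\<^bsub>L\<^esub> x, H +>\<^bsub>L\<^esub> y) = coboundary L M \<phi> (x, y)"
  using coboundary_coset_cong[OF assms(1,2) some_coset assms(3) some_coset] assms
  by (simp add: tr_cocycle_def coset_mem_quot_lie)

lemma tr_cocycle_PiE:
  "\<phi> \<in> rel_cochains \<Longrightarrow> tr_cocycle \<phi> \<in>
    carrier (quot_lie L H) \<times> carrier (quot_lie L H) \<rightarrow>\<^sub>E carrier (ideal_invariants H M)"
  unfolding PiE_iff
  by (auto elim!: quot_lie_cases simp: tr_cocycle_coset coboundary_annihilated)
    (simp add: tr_cocycle_def)

lemma tr_cocycle_Z2:
  assumes \<phi>: "\<phi> \<in> rel_cochains"
  shows "tr_cocycle \<phi> \<in> Z2 K (quot_lie L H) (ideal_invariants H M)"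
proof -
  note Z = coboundary_rel_Z2[OF \<phi>]
  have "(\<lambda>Y. tr_cocycle \<phi> (X, Y)) \<in> lin_hom K (quot_lie L H) (ideal_invariants H M)"
    if "X \<in> carrier (quot_lie L H)" for X
    using that
    by (intro lin_homI) (auto elim!: quot_lie_cases simp: tr_cocycle_coset[OF \<phi>]
      coboundary_annihilated[OF \<phi>] add_quot_lie smult_quot_lie lin_hom_add[OF Z2_lin_right[OF Z]]
      lin_hom_smult[OF Z2_lin_right[OF Z]])
  moreover have "(\<lambda>X. tr_cocycle \<phi> (X, Y)) \<in> lin_hom K (quot_lie L H) (ideal_invariants H M)"
    if "Y \<in> carrier (quot_lie L H)" for Y
    using that
    by (intro lin_homI) (auto elim!: quot_lie_cases simp: tr_cocycle_coset[OF \<phi>]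
      coboundary_annihilated[OF \<phi>] add_quot_lie smult_quot_lie lin_hom_add[OF Z2_lin_left[OF Z]]
      lin_hom_smult[OF Z2_lin_left[OF Z]])
  moreover have "tr_cocycle \<phi> (X, X) = \<zero>\<^bsub>M\<^esub>" if "X \<in> carrier (quot_lie L H)" for X
    using that by (auto elim!: quot_lie_cases simp: tr_cocycle_coset[OF \<phi>] Z2_alternating[OF Z])
  ultimately show ?thesis
    using tr_cocycle_PiE[OF \<phi>] unfolding Z2_def
    by (auto elim!: quot_lie_cases simp: tr_cocycle_coset[OF \<phi>] act_ideal_invariants
        coboundary_annihilated[OF \<phi>] bracket_quot_lie bracket_closed Z2_cocycle[OF Z])
qed

lemma inflate_apply:
  "\<lbrakk>x \<in> carrier L; y \<in> carrier L\<rbrakk> \<Longrightarrow> inflate L H f (x, y) = f (H +>\<^bsub>L\<^esub> x, H +>\<^bsub>L\<^esub> y)"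
  by (simp add: inflate_def)

lemma inflate_tr_cocycle: "\<phi> \<in> rel_cochains \<Longrightarrow> inflate L H (tr_cocycle \<phi>) = coboundary L M \<phi>"
  by (auto simp: inflate_def tr_cocycle_coset coboundary_def intro!: restrict_ext)

text \<open>Only extensionality of the two functions matters; A and B are kept separate so that one
  of them can be \<open>UNIV\<close> where closure of the values is not at hand.\<close>

lemma quot_fun_eqI:
  assumes "f \<in> carrier (quot_lie L H) \<times> carrier (quot_lie L H) \<rightarrow>\<^sub>E A"
    "g \<in> carrier (quot_lie L H) \<times> carrier (quot_lie L H) \<rightarrow>\<^sub>E B"
    "\<And>x y. \<lbrakk>x \<in> carrier L; y \<in> carrier L\<rbrakk> \<Longrightarrow>
      f (H +>\<^bsub>L\<^esub> x, H +>\<^bsub>L\<^esub> y) = g (H +>\<^bsub>L\<^esub> x, H +>\<^bsub>L\<^esub> y)"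
  shows "f = g"
proof (rule extensionalityI)
  fix p assume "p \<in> carrier (quot_lie L H) \<times> carrier (quot_lie L H)"
  then show "f p = g p" using assms(3) by (auto elim!: quot_lie_cases)
qed (use assms in \<open>auto simp: PiE_def\<close>)

text \<open>Every element of the quotient is a coset, so a cochain on g/h is recovered from its
  inflation. The equality is one of functions, not merely of classes.\<close>

lemma tr_cocycle_unique:
  assumes f: "f \<in> carrier (quot_lie L H) \<times> carrier (quot_lie L H) \<rightarrow>\<^sub>E annihilated H M"
    and \<phi>: "\<phi> \<in> rel_cochains" "inflate L H f = coboundary L M \<phi>"
  shows "f = tr_cocycle \<phi>"
proof (rule quot_fun_eqI[OF f tr_cocycle_PiE[OF \<phi>(1)]])
  show "f (H +>\<^bsub>L\<^esub> x, H +>\<^bsub>L\<^esub> y) = tr_cocycle \<phi> (H +>\<^bsub>L\<^esub> x, H +>\<^bsub>L\<^esub> y)"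
    if "x \<in> carrier L" "y \<in> carrier L" for x y
    using fun_cong[OF \<phi>(2), of "(x, y)"] that by (simp add: inflate_apply tr_cocycle_coset[OF \<phi>(1)])
qed

lemma rel_cochain_if_inflate:
  assumes f: "f \<in> Z2 K (quot_lie L H) (ideal_invariants H M)"
    and \<phi>: "\<phi> \<in> lin_hom K L M" "inflate L H f = coboundary L M \<phi>"
  shows "\<phi> \<in> rel_cochains"
proof -
  have "coboundary L M \<phi> (x, z) = \<zero>\<^bsub>M\<^esub>" if "x \<in> carrier L" "z \<in> H" for x z
  proof -
    have lin: "(\<lambda>Y. f (H +>\<^bsub>L\<^esub> x, Y)) \<in> lin_hom K (quot_lie L H) (ideal_invariants H M)"
      using inv.Z2_lin_right[OF f coset_mem_quot_lie] that by simp
    \<comment> \<open>The coset of z in h is the zero of the quotient, where a map linear in its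
      second argument vanishes.\<close>
    have "coboundary L M \<phi> (x, z) = f (H +>\<^bsub>L\<^esub> x, \<zero>\<^bsub>quot_lie L H\<^esub>)"
      using that by (simp add: \<phi>(2)[symmetric] inflate_apply ideal_carrier zero_quot_lie
          quot.coset_eq_self_iff[THEN iffD2])
    also have "\<dots> = \<zero>\<^bsub>M\<^esub>"
      using lin_hom_zero[OF inv.L.M.abelian_group_axioms inv.M.abelian_group_axioms lin] by simp
    finally show ?thesis .
  qed
  with \<phi>(1) show ?thesis by (simp add: rel_cochains_iff)
qed

lemma tr_cocycle_add:
  assumes "\<phi> \<in> rel_cochains" "\<psi> \<in> rel_cochains"
  shows "tr_cocycle (\<lambda>x. \<phi> x \<oplus>\<^bsub>M\<^esub> \<psi> x) = tr_cocycle \<phi>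
    \<oplus>\<^bsub>fun_module (carrier (quot_lie L H) \<times> carrier (quot_lie L H)) (ideal_invariants H M)\<^esub> tr_cocycle \<psi>"
proof (rule quot_fun_eqI[where B = UNIV])
  show "tr_cocycle (\<lambda>x. \<phi> x \<oplus>\<^bsub>M\<^esub> \<psi> x) \<in> carrier (quot_lie L H) \<times> carrier (quot_lie L H) \<rightarrow>\<^sub>E
      carrier (ideal_invariants H M)"
    by (intro tr_cocycle_PiE rel_cochains_add assms)
qed (auto simp: fun_module_def tr_cocycle_coset assms rel_cochains_add coset_mem_quot_lie
    coboundary_add rel_cochains_lin)

lemma tr_cocycle_smult:
  assumes "c \<in> carrier K" "\<phi> \<in> rel_cochains"
  shows "tr_cocycle (\<lambda>x. c \<odot>\<^bsub>M\<^esub> \<phi> x) =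
    c \<odot>\<^bsub>fun_module (carrier (quot_lie L H) \<times> carrier (quot_lie L H)) (ideal_invariants H M)\<^esub> tr_cocycle \<phi>"
proof (rule quot_fun_eqI[where B = UNIV])
  show "tr_cocycle (\<lambda>x. c \<odot>\<^bsub>M\<^esub> \<phi> x) \<in> carrier (quot_lie L H) \<times> carrier (quot_lie L H) \<rightarrow>\<^sub>E
      carrier (ideal_invariants H M)"
    by (intro tr_cocycle_PiE rel_cochains_smult assms)
qed (auto simp: fun_module_def tr_cocycle_coset assms rel_cochains_smult coset_mem_quot_lie
    coboundary_smult rel_cochains_lin)

text \<open>The added cochain has zero coboundary by \<open>coboundary_inner\<close>. As it
  restricts to an inner derivation of h, this yields independence of \<open>tr\<close> from the
  representative of a class.\<close>

lemma tr_cocycle_add_inner: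
  assumes "\<phi> \<in> rel_cochains" "n \<in> carrier M"
  shows "tr_cocycle (\<lambda>x. (x \<rhd>\<^bsub>M\<^esub> n) \<oplus>\<^bsub>M\<^esub> \<phi> x) = tr_cocycle \<phi>"
proof -
  have "coboundary L M (\<lambda>x. (x \<rhd>\<^bsub>M\<^esub> n) \<oplus>\<^bsub>M\<^esub> \<phi> x) = coboundary L M \<phi>"
    using coboundary_PiE[OF rel_cochains_lin[OF assms(1)]] assms
    by (simp add: coboundary_add act_left_hom rel_cochains_lin coboundary_inner)
      (rule cochains.V.M.l_zero, simp add: fun_module_def)
  then show ?thesis by (simp add: tr_cocycle_def)
qed

text \<open>The difference \<phi> - \<psi> vanishes on h, hence is constant on cosets, and it has
  values in the h-invariants because z . \<phi> x = x . \<phi> z - \<phi> [x, z] depends only on the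
  restriction to h. It descends to a linear map \<chi> on the quotient whose coboundary is the
  difference of the two cocycles.\<close>

lemma tr_cocycle_class_eq:
  assumes \<phi>: "\<phi> \<in> rel_cochains" and \<psi>: "\<psi> \<in> rel_cochains"
    and eq: "\<And>z. z \<in> H \<Longrightarrow> \<phi> z = \<psi> z"
  shows "H2_class K (quot_lie L H) (ideal_invariants H M) (tr_cocycle \<phi>) =
    H2_class K (quot_lie L H) (ideal_invariants H M) (tr_cocycle \<psi>)"
proof -
  note lin = rel_cochains_lin[OF \<phi>] rel_cochains_lin[OF \<psi>]
  note cl = lin_hom_closed[OF lin(1)] lin_hom_closed[OF lin(2)] act_closed bracket_closed
  define \<chi> where "\<chi> X = (let x = SOME x. x \<in> X in \<phi> x \<ominus>\<^bsub>M\<^esub> \<psi> x)" for X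
  have \<chi>: "\<chi> (H +>\<^bsub>L\<^esub> x) = \<phi> x \<ominus>\<^bsub>M\<^esub> \<psi> x" if x: "x \<in> carrier L" for x
  proof -
    define y where "y = (SOME y. y \<in> H +>\<^bsub>L\<^esub> x)"
    have y: "y \<in> H +>\<^bsub>L\<^esub> x" unfolding y_def by (rule some_coset[OF x])
    then have yL: "y \<in> carrier L" using x quot.coset_subset by blast
    have "\<phi> (y \<ominus>\<^bsub>L\<^esub> x) = \<psi> (y \<ominus>\<^bsub>L\<^esub> x)"
      by (rule eq) (rule quot.coset_diff[OF x y])
    then have "\<phi> y \<ominus>\<^bsub>M\<^esub> \<phi> x = \<psi> y \<ominus>\<^bsub>M\<^esub> \<psi> x"
      using x yL lin_hom_minus[OF L.M.abelian_group_axioms M.abelian_group_axioms] lin by metis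
    then have "\<phi> y \<ominus>\<^bsub>M\<^esub> \<psi> y = \<phi> x \<ominus>\<^bsub>M\<^esub> \<psi> x"
      using x yL by (simp add: cl M.minus_simps)
    then show ?thesis by (simp add: \<chi>_def y_def[symmetric])
  qed
  have ann: "\<phi> x \<ominus>\<^bsub>M\<^esub> \<psi> x \<in> annihilated H M" if x: "x \<in> carrier L" for x
  proof -
    have "z \<rhd>\<^bsub>M\<^esub> (\<phi> x \<ominus>\<^bsub>M\<^esub> \<psi> x) = \<zero>\<^bsub>M\<^esub>" if z: "z \<in> H" for z
    proof -
      have "(x \<rhd>\<^bsub>M\<^esub> \<phi> z) \<ominus>\<^bsub>M\<^esub> (z \<rhd>\<^bsub>M\<^esub> \<phi> x) = (x \<rhd>\<^bsub>M\<^esub> \<phi> z) \<ominus>\<^bsub>M\<^esub> (z \<rhd>\<^bsub>M\<^esub> \<psi> x)"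
        using rel_cochainsD[OF \<phi> x z] rel_cochainsD[OF \<psi> x z] eq x z ideal_closed by simp
      then show ?thesis
        using x z by (simp add: act_minus_right cl ideal_carrier M.minus_simps)
    qed
    then show ?thesis using x by (simp add: annihilated_iff cl)
  qed
  have \<chi>_lin: "\<chi> \<in> lin_hom K (quot_lie L H) (ideal_invariants H M)"
    by (intro lin_homI) (auto elim!: quot_lie_cases simp: \<chi> ann add_quot_lie smult_quot_lie cl
      lin_hom_add[OF lin(1)] lin_hom_add[OF lin(2)] lin_hom_smult[OF lin(1)] lin_hom_smult[OF lin(2)]
      M.smult_r_diff M.minus_simps)
  let ?F = "fun_module (carrier (quot_lie L H) \<times> carrier (quot_lie L H)) (ideal_invariants H M)"
  let ?\<delta> = "coboundary (quot_lie L H) (ideal_invariants H M) \<chi>"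
  \<comment> \<open>Nested subtractions in the module of invariants are rewritten to those of M by
    \<open>minus_ideal_invariants\<close>, which asks that the inner difference be known to be
    invariant.\<close>
  have ann_\<delta>: "(x \<rhd>\<^bsub>M\<^esub> (\<phi> y \<ominus>\<^bsub>M\<^esub> \<psi> y)) \<ominus>\<^bsub>M\<^esub> (y \<rhd>\<^bsub>M\<^esub> (\<phi> x \<ominus>\<^bsub>M\<^esub> \<psi> x)) \<in> annihilated H M"
    if "x \<in> carrier L" "y \<in> carrier L" for x y
    using inv.M.minus_closed[of "x \<rhd>\<^bsub>M\<^esub> (\<phi> y \<ominus>\<^bsub>M\<^esub> \<psi> y)" "y \<rhd>\<^bsub>M\<^esub> (\<phi> x \<ominus>\<^bsub>M\<^esub> \<psi> x)"] that
    by (simp add: minus_ideal_invariants ann act_annihilated)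
  have "tr_cocycle \<phi> = ?\<delta> \<oplus>\<^bsub>?F\<^esub> tr_cocycle \<psi>"
  proof (rule quot_fun_eqI[OF tr_cocycle_PiE[OF \<phi>], where B = UNIV])
    fix x y assume xy: "x \<in> carrier L" "y \<in> carrier L"
    have "?\<delta> (H +>\<^bsub>L\<^esub> x, H +>\<^bsub>L\<^esub> y) = (x \<rhd>\<^bsub>M\<^esub> (\<phi> y \<ominus>\<^bsub>M\<^esub> \<psi> y)) \<ominus>\<^bsub>M\<^esub> (y \<rhd>\<^bsub>M\<^esub> (\<phi> x \<ominus>\<^bsub>M\<^esub> \<psi> x))
        \<ominus>\<^bsub>M\<^esub> (\<phi> \<lbrace>x, y\<rbrace>\<^bsub>L\<^esub> \<ominus>\<^bsub>M\<^esub> \<psi> \<lbrace>x, y\<rbrace>\<^bsub>L\<^esub>)"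
      using xy by (simp add: coboundary_apply coset_mem_quot_lie bracket_quot_lie \<chi> bracket_closed
          act_ideal_invariants ann act_annihilated minus_ideal_invariants ann_\<delta>)
    then show "tr_cocycle \<phi> (H +>\<^bsub>L\<^esub> x, H +>\<^bsub>L\<^esub> y) =
        (?\<delta> \<oplus>\<^bsub>?F\<^esub> tr_cocycle \<psi>) (H +>\<^bsub>L\<^esub> x, H +>\<^bsub>L\<^esub> y)"
      using xy by (simp add: fun_module_def coset_mem_quot_lie tr_cocycle_coset \<phi> \<psi>)
        (simp add: coboundary_apply act_minus_right cl M.minus_simps)
  qed (auto simp: fun_module_def)
  then show ?thesis
    using inv.H2_class_eq_add[OF tr_cocycle_PiE[OF \<psi>], of ?\<delta>] \<chi>_lin
    by (simp add: B2_eq)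
qed

section \<open>Inflation on cohomology classes\<close>

lemma inflate_Z2:
  assumes f: "f \<in> Z2 K (quot_lie L H) (ideal_invariants H M)"
  shows "inflate L H f \<in> Z2 K L M"
proof -
  have cl: "f (H +>\<^bsub>L\<^esub> x, H +>\<^bsub>L\<^esub> y) \<in> annihilated H M" if "x \<in> carrier L" "y \<in> carrier L" for x y
    using inv.Z2_closed[OF f coset_mem_quot_lie coset_mem_quot_lie] that by simp
  have lin1: "(\<lambda>Y. f (H +>\<^bsub>L\<^esub> x, Y)) \<in> lin_hom K (quot_lie L H) (ideal_invariants H M)"
    if "x \<in> carrier L" for x
    by (rule inv.Z2_lin_right[OF f coset_mem_quot_lie[OF that]])
  have lin2: "(\<lambda>X. f (X, H +>\<^bsub>L\<^esub> x)) \<in> lin_hom K (quot_lie L H) (ideal_invariants H M)"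
    if "x \<in> carrier L" for x
    by (rule inv.Z2_lin_left[OF f coset_mem_quot_lie[OF that]])
  have "(\<lambda>y. inflate L H f (x, y)) \<in> lin_hom K L M" if "x \<in> carrier L" for x
    using that lin_hom_add[OF lin1[OF that] coset_mem_quot_lie coset_mem_quot_lie]
      lin_hom_smult[OF lin1[OF that] _ coset_mem_quot_lie]
    by (intro lin_homI)
      (simp_all add: inflate_apply annihilated_closed cl add_quot_lie smult_quot_lie)
  moreover have "(\<lambda>x. inflate L H f (x, y)) \<in> lin_hom K L M" if "y \<in> carrier L" for y
    using that lin_hom_add[OF lin2[OF that] coset_mem_quot_lie coset_mem_quot_lie]
      lin_hom_smult[OF lin2[OF that] _ coset_mem_quot_lie]
    by (intro lin_homI)
      (simp_all add: inflate_apply annihilated_closed cl add_quot_lie smult_quot_lie)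
  moreover have "inflate L H f (x, x) = \<zero>\<^bsub>M\<^esub>" if "x \<in> carrier L" for x
    using inv.Z2_alternating[OF f coset_mem_quot_lie] that by (simp add: inflate_apply)
  moreover have "(x \<rhd>\<^bsub>M\<^esub> inflate L H f (y, z)) \<oplus>\<^bsub>M\<^esub> (y \<rhd>\<^bsub>M\<^esub> inflate L H f (z, x))
      \<oplus>\<^bsub>M\<^esub> (z \<rhd>\<^bsub>M\<^esub> inflate L H f (x, y)) =
      inflate L H f (\<lbrace>x, y\<rbrace>\<^bsub>L\<^esub>, z) \<oplus>\<^bsub>M\<^esub> inflate L H f (\<lbrace>y, z\<rbrace>\<^bsub>L\<^esub>, x) \<oplus>\<^bsub>M\<^esub> inflate L H f (\<lbrace>z, x\<rbrace>\<^bsub>L\<^esub>, y)"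
    if xyz: "x \<in> carrier L" "y \<in> carrier L" "z \<in> carrier L" for x y z
  proof -
    show ?thesis
      using inv.Z2_cocycle[OF f xyz[THEN coset_mem_quot_lie]] xyz
      by (simp add: act_ideal_invariants cl bracket_quot_lie inflate_apply bracket_closed)
  qed
  moreover have "inflate L H f \<in> carrier L \<times> carrier L \<rightarrow>\<^sub>E carrier M"
    by (auto simp: inflate_def annihilated_closed cl)
  ultimately show ?thesis by (simp add: Z2_def)
qed

text \<open>Another representative is f plus the coboundary of some \<chi> on g/h; its inflation
  differs by the coboundary of \<chi> composed with the projection of g onto g/h.\<close>

lemma inflation_class:
  assumes f: "f \<in> carrier (quot_lie L H) \<times> carrier (quot_lie L H) \<rightarrow>\<^sub>E annihilated H M"
  shows "inflation K L H M (H2_class K (quot_lie L H) (ideal_invariants H M) f) =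
    H2_class K L M (inflate L H f)"
  unfolding inflation_def
proof (rule the_elem_image_eqI)
  show "f \<in> H2_class K (quot_lie L H) (ideal_invariants H M) f"
    unfolding H2_class_def using f by (intro inv.cochains.coset_self) (simp add: fun_module_def)
  fix g assume "g \<in> H2_class K (quot_lie L H) (ideal_invariants H M) f"
  then obtain \<chi> where \<chi>: "\<chi> \<in> lin_hom K (quot_lie L H) (ideal_invariants H M)"
    and g: "g = coboundary (quot_lie L H) (ideal_invariants H M) \<chi>
      \<oplus>\<^bsub>fun_module (carrier (quot_lie L H) \<times> carrier (quot_lie L H)) (ideal_invariants H M)\<^esub> f"
    by (auto simp: inv.mem_H2_class_iff B2_eq)
  have cl: "\<chi> (H +>\<^bsub>L\<^esub> x) \<in> annihilated H M" if "x \<in> carrier L" for x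
    using lin_hom_closed[OF \<chi> coset_mem_quot_lie[OF that]] by simp
  have \<chi>': "(\<lambda>x. \<chi> (H +>\<^bsub>L\<^esub> x)) \<in> lin_hom K L M"
    using lin_hom_add[OF \<chi> coset_mem_quot_lie coset_mem_quot_lie]
      lin_hom_smult[OF \<chi> _ coset_mem_quot_lie]
    by (intro lin_homI) (simp_all add: cl annihilated_closed add_quot_lie smult_quot_lie)
  have ann: "(x \<rhd>\<^bsub>M\<^esub> \<chi> (H +>\<^bsub>L\<^esub> y)) \<ominus>\<^bsub>M\<^esub> (y \<rhd>\<^bsub>M\<^esub> \<chi> (H +>\<^bsub>L\<^esub> x)) \<in> annihilated H M"
    if "x \<in> carrier L" "y \<in> carrier L" for x y
    using inv.M.minus_closed[of "x \<rhd>\<^bsub>M\<^esub> \<chi> (H +>\<^bsub>L\<^esub> y)" "y \<rhd>\<^bsub>M\<^esub> \<chi> (H +>\<^bsub>L\<^esub> x)"] that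
    by (simp add: minus_ideal_invariants cl act_annihilated)
  have "inflate L H g = coboundary L M (\<lambda>x. \<chi> (H +>\<^bsub>L\<^esub> x))
      \<oplus>\<^bsub>fun_module (carrier L \<times> carrier L) M\<^esub> inflate L H f"
    unfolding inflate_def g fun_module_def coboundary_def
    by (auto intro!: restrict_ext simp: coset_mem_quot_lie act_ideal_invariants cl bracket_quot_lie
        bracket_closed minus_ideal_invariants act_annihilated ann)
  moreover have "inflate L H f \<in> carrier L \<times> carrier L \<rightarrow>\<^sub>E carrier M"
    using f by (auto simp: inflate_def coset_mem_quot_lie PiE_mem[OF f] annihilated_closed)
  ultimately show "H2_class K L M (inflate L H g) = H2_class K L M (inflate L H f)"
    using \<chi>' by (simp add: H2_class_eq_add B2_eq)
qed

end

section \<open>Semidirect products and normalizers\<close>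

context lie_algebra
begin

lemma lie_algebra_subalgebra:
  assumes "submodule S K L" "\<And>x y. \<lbrakk>x \<in> S; y \<in> S\<rbrakk> \<Longrightarrow> \<lbrace>x, y\<rbrace> \<in> S"
  shows "lie_algebra K (L\<lparr>carrier := S\<rparr>)"
proof (intro lie_algebra.intro lie_algebra_axioms.intro)
  show "field K" by (rule K.field_axioms)
  show "module K (L\<lparr>carrier := S\<rparr>)"
    by (rule submodule.submodule_is_module[OF assms(1) L.module_axioms])
  have [simp]: "x \<in> S \<Longrightarrow> x \<in> carrier L" for x
    using submoduleE(1)[OF assms(1)] by blast
  show "x \<in> carrier (L\<lparr>carrier := S\<rparr>) \<Longrightarrow> y \<in> carrier (L\<lparr>carrier := S\<rparr>) \<Longrightarrow>
    \<lbrace>x, y\<rbrace>\<^bsub>L\<lparr>carrier := S\<rparr>\<^esub> \<in> carrier (L\<lparr>carrier := S\<rparr>)" for x y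
    by (simp add: assms(2))
qed (simp_all add: bracket_add_left bracket_add_right bracket_smult_left bracket_smult_right
    bracket_alternating jacobi submoduleE(1)[OF assms(1), THEN subsetD])

text \<open>The Jacobi identity in the form that ad [x, y] is the commutator of ad x and ad y, which
  is what closes a normalizer under the bracket.\<close>

lemma jacobi_derivation:
  assumes "x \<in> carrier L" "y \<in> carrier L" "z \<in> carrier L"
  shows "\<lbrace>\<lbrace>x, y\<rbrace>, z\<rbrace> = \<lbrace>x, \<lbrace>y, z\<rbrace>\<rbrace> \<ominus> \<lbrace>y, \<lbrace>x, z\<rbrace>\<rbrace>"
proof -
  have 1: "\<lbrace>\<lbrace>x, y\<rbrace>, z\<rbrace> = \<ominus> \<lbrace>z, \<lbrace>x, y\<rbrace>\<rbrace>"
    using assms by (intro bracket_anticomm bracket_closed)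
  have 2: "\<lbrace>y, \<lbrace>z, x\<rbrace>\<rbrace> = \<ominus> \<lbrace>y, \<lbrace>x, z\<rbrace>\<rbrace>"
    using assms lin_hom_a_inv[OF M.abelian_group_axioms M.abelian_group_axioms bracket_right_hom[of y]]
    by (simp add: bracket_anticomm[of z x] bracket_closed)
  have 3: "\<lbrace>z, \<lbrace>x, y\<rbrace>\<rbrace> = \<ominus> (\<lbrace>x, \<lbrace>y, z\<rbrace>\<rbrace> \<oplus> \<lbrace>y, \<lbrace>z, x\<rbrace>\<rbrace>)"
    using jacobi[OF assms] assms by (simp add: bracket_closed M.minus_simps)
  show ?thesis
    unfolding 1 3 2 using assms by (simp add: bracket_closed M.minus_simps)
qed

text \<open>If x and y normalize S, then \<open>jacobi_derivation\<close> writes [[x, y], s] as a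
  difference of elements of S. Being closed under brackets, S lies in its normalizer, and there it
  is an ideal by construction.\<close>

lemma lie_ideal_normalizer:
  assumes S: "submodule S K L" and br: "\<And>x y. \<lbrakk>x \<in> S; y \<in> S\<rbrakk> \<Longrightarrow> \<lbrace>x, y\<rbrace> \<in> S"
  shows "lie_ideal S K (L\<lparr>carrier := lie_normalizer L S\<rparr>)"
    and "submodule (lie_normalizer L S) K L"
proof -
  note SE = submoduleE[OF S]
  have carr: "x \<in> S \<Longrightarrow> x \<in> carrier L" for x using SE(1) by blast
  have z: "\<zero> \<in> S" using subgroup.one_closed[OF submodule.axioms(1)[OF S]] by simp
  have diff: "a \<ominus> b \<in> S" if "a \<in> S" "b \<in> S" for a b
    using that SE by (simp add: a_minus_def)
  show N: "submodule (lie_normalizer L S) K L"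
    by (rule L.submoduleI_smult)
      (auto simp: lie_normalizer_def bracket_zero_left bracket_add_left bracket_smult_left carr z
        SE(4,5))
  have sub: "lie_algebra K (L\<lparr>carrier := lie_normalizer L S\<rparr>)"
    by (rule lie_algebra_subalgebra[OF N])
      (auto simp: lie_normalizer_def bracket_closed jacobi_derivation carr diff)
  have SN: "S \<subseteq> lie_normalizer L S"
    using br carr by (auto simp: lie_normalizer_def)
  have "submodule S K (L\<lparr>carrier := lie_normalizer L S\<rparr>)"
  proof (rule module.submoduleI_smult[OF lie_algebra.axioms(2)[OF sub]])
  qed (use SN z SE in auto)
  then show "lie_ideal S K (L\<lparr>carrier := lie_normalizer L S\<rparr>)"
    using sub by (intro lie_ideal.intro lie_ideal_axioms.intro) (auto simp: lie_normalizer_def)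
qed

end

context lie_module
begin

lemma semidirect_sel:
  "carrier (semidirect M L) = carrier M \<times> carrier L" "\<zero>\<^bsub>semidirect M L\<^esub> = (\<zero>\<^bsub>M\<^esub>, \<zero>\<^bsub>L\<^esub>)"
  "(m, x) \<oplus>\<^bsub>semidirect M L\<^esub> (n, y) = (m \<oplus>\<^bsub>M\<^esub> n, x \<oplus>\<^bsub>L\<^esub> y)"
  "c \<odot>\<^bsub>semidirect M L\<^esub> (m, x) = (c \<odot>\<^bsub>M\<^esub> m, c \<odot>\<^bsub>L\<^esub> x)"
  "\<lbrace>(m, x), (n, y)\<rbrace>\<^bsub>semidirect M L\<^esub> = ((x \<rhd>\<^bsub>M\<^esub> n) \<ominus>\<^bsub>M\<^esub> (y \<rhd>\<^bsub>M\<^esub> m), \<lbrace>x, y\<rbrace>\<^bsub>L\<^esub>)"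
  by (simp_all add: semidirect_def)

lemma module_semidirect: "module K (semidirect M L)"
proof (rule moduleI)
  show "abelian_group (semidirect M L)"
  proof (rule abelian_groupI)
    fix p assume "p \<in> carrier (semidirect M L)"
    then obtain m x where "p = (m, x)" "m \<in> carrier M" "x \<in> carrier L"
      by (auto simp: semidirect_sel)
    then show "\<exists>q\<in>carrier (semidirect M L). q \<oplus>\<^bsub>semidirect M L\<^esub> p = \<zero>\<^bsub>semidirect M L\<^esub>"
      by (intro bexI[of _ "(\<ominus>\<^bsub>M\<^esub> m, \<ominus>\<^bsub>L\<^esub> x)"]) (simp_all add: semidirect_sel M.l_neg L.M.l_neg)
  qed (auto simp: semidirect_sel M.a_ac L.M.a_ac)
qed (auto simp: semidirect_sel M.smult_l_distr L.smult_l_distr M.smult_r_distr L.smult_r_distr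
    M.smult_assoc1 L.smult_assoc1 is_cring)

lemma a_inv_semidirect:
  assumes "m \<in> carrier M" "x \<in> carrier L"
  shows "\<ominus>\<^bsub>semidirect M L\<^esub> (m, x) = (\<ominus>\<^bsub>M\<^esub> m, \<ominus>\<^bsub>L\<^esub> x)"
proof -
  interpret S: module K "semidirect M L" by (rule module_semidirect)
  show ?thesis
    by (rule S.minus_equality) (use assms in \<open>simp_all add: semidirect_sel M.l_neg L.M.l_neg\<close>)
qed

lemma minus_semidirect:
  "\<lbrakk>m \<in> carrier M; x \<in> carrier L; n \<in> carrier M; y \<in> carrier L\<rbrakk> \<Longrightarrow>
    (m, x) \<ominus>\<^bsub>semidirect M L\<^esub> (n, y) = (m \<ominus>\<^bsub>M\<^esub> n, x \<ominus>\<^bsub>L\<^esub> y)"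
  by (simp add: a_minus_def a_inv_semidirect semidirect_sel)

lemma lie_algebra_semidirect: "lie_algebra K (semidirect M L)"
proof (intro lie_algebra.intro lie_algebra_axioms.intro)
  show "field K" by (rule K.field_axioms)
  show "module K (semidirect M L)" by (rule module_semidirect)
  fix p q r assume "p \<in> carrier (semidirect M L)" "q \<in> carrier (semidirect M L)"
    "r \<in> carrier (semidirect M L)"
  then obtain m x n y o' z where *: "p = (m, x)" "q = (n, y)" "r = (o', z)"
    "m \<in> carrier M" "x \<in> carrier L" "n \<in> carrier M" "y \<in> carrier L" "o' \<in> carrier M" "z \<in> carrier L"
    by (auto simp: semidirect_sel)
  \<comment> \<open>The second component is the Jacobi identity of L; in the first,
    \<open>act_bracket\<close> expands all terms and they cancel.\<close>
  then show "\<lbrace>p, \<lbrace>q, r\<rbrace>\<^bsub>semidirect M L\<^esub>\<rbrace>\<^bsub>semidirect M L\<^esub> \<oplus>\<^bsub>semidirect M L\<^esub>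
      \<lbrace>q, \<lbrace>r, p\<rbrace>\<^bsub>semidirect M L\<^esub>\<rbrace>\<^bsub>semidirect M L\<^esub> \<oplus>\<^bsub>semidirect M L\<^esub>
      \<lbrace>r, \<lbrace>p, q\<rbrace>\<^bsub>semidirect M L\<^esub>\<rbrace>\<^bsub>semidirect M L\<^esub> = \<zero>\<^bsub>semidirect M L\<^esub>"
    by (simp add: semidirect_sel jacobi act_bracket act_minus_right act_closed)
      (simp add: act_closed M.minus_simps)
qed (auto simp: semidirect_sel act_closed bracket_closed act_add_left act_add_right bracket_add_left
    bracket_add_right act_smult_left act_smult_right bracket_smult_left bracket_smult_right
    bracket_alternating M.smult_r_diff M.minus_simps)

end

section \<open>The extension attached to a derivation of the ideal\<close>

text \<open>The locale fixes the derivation rule; invariance of the class of \<open>d\<close> enters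
  through the hypothesis of \<open>ex_rel_cochain\<close> or through a given relative cochain that
  extends \<open>d\<close>.\<close>

locale ideal_derivation = lie_ideal_module H K L M
  for H and K :: "('k, 'c) ring_scheme" and L :: "('k, 'g, 'd) lie_algebra_scheme" (structure)
    and M :: "('k, 'g, 'm, 'e) lie_module_scheme" (structure) +
  fixes d assumes der: "d \<in> Der K (L\<lparr>carrier := H\<rparr>) M"
begin

lemma der_lin: "d \<in> lin_hom K (L\<lparr>carrier := H\<rparr>) M"
  using der by (simp add: Der_def)

lemma der_closed: "z \<in> H \<Longrightarrow> d z \<in> carrier M"
  using lin_hom_closed[OF der_lin] by simp

lemma der_add: "\<lbrakk>z \<in> H; w \<in> H\<rbrakk> \<Longrightarrow> d (z \<oplus>\<^bsub>L\<^esub> w) = d z \<oplus>\<^bsub>M\<^esub> d w"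
  using lin_hom_add[OF der_lin] by simp

lemma der_smult: "\<lbrakk>c \<in> carrier K; z \<in> H\<rbrakk> \<Longrightarrow> d (c \<odot>\<^bsub>L\<^esub> z) = c \<odot>\<^bsub>M\<^esub> d z"
  using lin_hom_smult[OF der_lin] by simp

lemma der_bracket: "\<lbrakk>z \<in> H; w \<in> H\<rbrakk> \<Longrightarrow> d \<lbrace>z, w\<rbrace>\<^bsub>L\<^esub> = (z \<rhd>\<^bsub>M\<^esub> d w) \<ominus>\<^bsub>M\<^esub> (w \<rhd>\<^bsub>M\<^esub> d z)"
  using der by (simp add: Der_def)

lemma der_zero: "d \<zero>\<^bsub>L\<^esub> = \<zero>\<^bsub>M\<^esub>"
proof -
  have "d \<zero>\<^bsub>L\<^esub> \<oplus>\<^bsub>M\<^esub> d \<zero>\<^bsub>L\<^esub> = d \<zero>\<^bsub>L\<^esub>"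
    using der_add[of "\<zero>\<^bsub>L\<^esub>" "\<zero>\<^bsub>L\<^esub>"] by (simp add: ideal_zero)
  then show ?thesis
    using der_closed[OF ideal_zero] by (metis M.add.r_cancel_one')
qed

abbreviation "graph \<equiv> der_graph H d"
abbreviation "normalizer \<equiv> lie_normalizer (semidirect M L) graph"

lemma mem_graph_iff: "(m, z) \<in> graph \<longleftrightarrow> z \<in> H \<and> m = d z"
  by (auto simp: der_graph_def)

text \<open>The bracket of (m, x) with (d z, z) has second component [x, z], so it lies on the graph
  iff its first component is d [x, z]. Rearranged, x acts on d as the inner derivation of m; the
  class of d is invariant exactly when every x admits such an m.\<close>

lemma mem_normalizer_iff:
  "(m, x) \<in> normalizer \<longleftrightarrow> m \<in> carrier M \<and> x \<in> carrier L \<and>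
    (\<forall>z\<in>H. (x \<rhd>\<^bsub>M\<^esub> d z) \<ominus>\<^bsub>M\<^esub> (z \<rhd>\<^bsub>M\<^esub> m) = d \<lbrace>x, z\<rbrace>\<^bsub>L\<^esub>)"
  by (auto simp: lie_normalizer_def semidirect_sel mem_graph_iff ideal_closed)
    (auto simp: der_graph_def semidirect_sel ideal_closed)

lemma normalizer_closed: "(m, x) \<in> normalizer \<Longrightarrow> m \<in> carrier M \<and> x \<in> carrier L"
  by (simp add: mem_normalizer_iff)

lemma submodule_graph: "submodule graph K (semidirect M L)"
proof (rule module.submoduleI_smult[OF module_semidirect])
  show "graph \<subseteq> carrier (semidirect M L)"
    by (auto simp: der_graph_def semidirect_sel der_closed ideal_carrier)
  show "\<zero>\<^bsub>semidirect M L\<^esub> \<in> graph"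
    by (simp add: semidirect_sel mem_graph_iff der_zero ideal_zero)
qed (auto simp: der_graph_def semidirect_sel der_add[symmetric] der_smult[symmetric] ideal_add
    smult_closed)

lemma graph_bracket: "\<lbrakk>p \<in> graph; q \<in> graph\<rbrakk> \<Longrightarrow> \<lbrace>p, q\<rbrace>\<^bsub>semidirect M L\<^esub> \<in> graph"
  by (auto simp: der_graph_def semidirect_sel der_bracket[symmetric] ideal_closed ideal_carrier)

text \<open>By the derivation rule the graph is a subalgebra, hence an ideal of its normalizer, and
  everything shown for the quotient by an ideal applies to the middle term of the extension.\<close>

sublocale ext: lie_ideal graph K "(semidirect M L)\<lparr>carrier := normalizer\<rparr>"
  by (rule lie_algebra.lie_ideal_normalizer(1)[OF lie_algebra_semidirect submodule_graph graph_bracket])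

lemma submodule_normalizer: "submodule normalizer K (semidirect M L)"
  by (rule lie_algebra.lie_ideal_normalizer(2)[OF lie_algebra_semidirect submodule_graph graph_bracket])

lemma tr_algebra_eq: "tr_algebra L H M d = quot_lie ((semidirect M L)\<lparr>carrier := normalizer\<rparr>) graph"
  by (simp add: tr_algebra_def)

abbreviation gcoset :: "'m \<times> 'g \<Rightarrow> ('m \<times> 'g) set" where
  "gcoset p \<equiv> graph +>\<^bsub>semidirect M L\<^esub> p"

lemma gcoset_eq_iff:
  assumes "(m, x) \<in> normalizer" "(n, y) \<in> normalizer"
  shows "gcoset (m, x) = gcoset (n, y) \<longleftrightarrow> x \<ominus>\<^bsub>L\<^esub> y \<in> H \<and> m \<ominus>\<^bsub>M\<^esub> n = d (x \<ominus>\<^bsub>L\<^esub> y)"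
proof -
  have "gcoset (m, x) = gcoset (n, y) \<longleftrightarrow>
      (m, x) \<ominus>\<^bsub>(semidirect M L)\<lparr>carrier := normalizer\<rparr>\<^esub> (n, y) \<in> graph"
    using ext.quot.coset_eq_iff[of "(m, x)" "(n, y)"] assms by simp
  also have "(m, x) \<ominus>\<^bsub>(semidirect M L)\<lparr>carrier := normalizer\<rparr>\<^esub> (n, y) = (m \<ominus>\<^bsub>M\<^esub> n, x \<ominus>\<^bsub>L\<^esub> y)"
  proof -
    \<comment> \<open>Negatives depend on the carrier of the record; by uniqueness those of the
      normalizer are those of the semidirect product.\<close>
    have "\<ominus>\<^bsub>(semidirect M L)\<lparr>carrier := normalizer\<rparr>\<^esub> (n, y) = \<ominus>\<^bsub>semidirect M L\<^esub> (n, y)"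
    proof (rule ext.L.M.minus_equality)
      interpret S: module K "semidirect M L" by (rule module_semidirect)
      show "\<ominus>\<^bsub>semidirect M L\<^esub> (n, y) \<in> carrier ((semidirect M L)\<lparr>carrier := normalizer\<rparr>)"
        using S.submoduleE(3)[OF submodule_normalizer] assms(2) by simp
      show "(\<ominus>\<^bsub>semidirect M L\<^esub> (n, y)) \<oplus>\<^bsub>(semidirect M L)\<lparr>carrier := normalizer\<rparr>\<^esub> (n, y) =
          \<zero>\<^bsub>(semidirect M L)\<lparr>carrier := normalizer\<rparr>\<^esub>"
        using normalizer_closed[OF assms(2)] by (simp add: S.M.l_neg semidirect_sel)
    qed (use assms in simp)
    then show ?thesis
      using assms normalizer_closed minus_semidirect by (simp add: a_minus_def)
  qed
  finally show ?thesis by (simp add: mem_graph_iff)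
qed

lemma tr_algebra_cases:
  assumes "Y \<in> carrier (tr_algebra L H M d)"
  obtains m x where "(m, x) \<in> normalizer" "Y = gcoset (m, x)"
  using ext.quot_lie_cases[of Y] assms unfolding tr_algebra_eq by auto

lemma gcoset_mem_tr_algebra: "p \<in> normalizer \<Longrightarrow> gcoset p \<in> carrier (tr_algebra L H M d)"
  using ext.coset_mem_quot_lie[of p] unfolding tr_algebra_eq by simp

lemma zero_tr_algebra: "\<zero>\<^bsub>tr_algebra L H M d\<^esub> = graph"
  unfolding tr_algebra_eq by (rule ext.zero_quot_lie)

lemma add_tr_algebra:
  "\<lbrakk>(m, x) \<in> normalizer; (n, y) \<in> normalizer\<rbrakk> \<Longrightarrow>
    gcoset (m, x) \<oplus>\<^bsub>tr_algebra L H M d\<^esub> gcoset (n, y) = gcoset (m \<oplus>\<^bsub>M\<^esub> n, x \<oplus>\<^bsub>L\<^esub> y)"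
  using ext.add_quot_lie[of "(m, x)" "(n, y)"] unfolding tr_algebra_eq by (simp add: semidirect_sel)

lemma smult_tr_algebra:
  "\<lbrakk>c \<in> carrier K; (m, x) \<in> normalizer\<rbrakk> \<Longrightarrow>
    c \<odot>\<^bsub>tr_algebra L H M d\<^esub> gcoset (m, x) = gcoset (c \<odot>\<^bsub>M\<^esub> m, c \<odot>\<^bsub>L\<^esub> x)"
  using ext.smult_quot_lie[of c "(m, x)"] unfolding tr_algebra_eq by (simp add: semidirect_sel)

lemma bracket_tr_algebra:
  "\<lbrakk>(m, x) \<in> normalizer; (n, y) \<in> normalizer\<rbrakk> \<Longrightarrow>
    \<lbrace>gcoset (m, x), gcoset (n, y)\<rbrace>\<^bsub>tr_algebra L H M d\<^esub> =
      gcoset ((x \<rhd>\<^bsub>M\<^esub> n) \<ominus>\<^bsub>M\<^esub> (y \<rhd>\<^bsub>M\<^esub> m), \<lbrace>x, y\<rbrace>\<^bsub>L\<^esub>)"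
  using ext.bracket_quot_lie[of "(m, x)" "(n, y)"] unfolding tr_algebra_eq by (simp add: semidirect_sel)

lemma normalizer_bracket:
  "\<lbrakk>(m, x) \<in> normalizer; (n, y) \<in> normalizer\<rbrakk> \<Longrightarrow>
    ((x \<rhd>\<^bsub>M\<^esub> n) \<ominus>\<^bsub>M\<^esub> (y \<rhd>\<^bsub>M\<^esub> m), \<lbrace>x, y\<rbrace>\<^bsub>L\<^esub>) \<in> normalizer"
  using ext.bracket_closed[of "(m, x)" "(n, y)"] by (simp add: semidirect_sel)

lemma normalizer_add:
  "\<lbrakk>(m, x) \<in> normalizer; (n, y) \<in> normalizer\<rbrakk> \<Longrightarrow> (m \<oplus>\<^bsub>M\<^esub> n, x \<oplus>\<^bsub>L\<^esub> y) \<in> normalizer"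
  using ext.L.M.a_closed[of "(m, x)" "(n, y)"] by (simp add: semidirect_sel)

lemma minus_tr_algebra:
  assumes "(m, x) \<in> normalizer" "(n, y) \<in> normalizer"
  shows "(m \<ominus>\<^bsub>M\<^esub> n, x \<ominus>\<^bsub>L\<^esub> y) \<in> normalizer"
    and "gcoset (m, x) \<ominus>\<^bsub>tr_algebra L H M d\<^esub> gcoset (n, y) = gcoset (m \<ominus>\<^bsub>M\<^esub> n, x \<ominus>\<^bsub>L\<^esub> y)"
proof -
  interpret S: module K "semidirect M L" by (rule module_semidirect)
  interpret E: module K "tr_algebra L H M d"
    unfolding tr_algebra_eq by (rule ext.module_quot_lie)
  note cl = normalizer_closed[OF assms(1)] normalizer_closed[OF assms(2)]
  have "(m, x) \<ominus>\<^bsub>semidirect M L\<^esub> (n, y) \<in> normalizer"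
    using S.submoduleE(3,5)[OF submodule_normalizer] assms by (simp add: a_minus_def)
  then show N: "(m \<ominus>\<^bsub>M\<^esub> n, x \<ominus>\<^bsub>L\<^esub> y) \<in> normalizer"
    using cl by (simp add: minus_semidirect)
  have "gcoset (m \<ominus>\<^bsub>M\<^esub> n, x \<ominus>\<^bsub>L\<^esub> y) \<oplus>\<^bsub>tr_algebra L H M d\<^esub> gcoset (n, y) = gcoset (m, x)"
    using add_tr_algebra[OF N assms(2)] cl
    by (simp add: a_minus_def M.a_assoc M.l_neg L.M.a_assoc L.M.l_neg)
  then show "gcoset (m, x) \<ominus>\<^bsub>tr_algebra L H M d\<^esub> gcoset (n, y) = gcoset (m \<ominus>\<^bsub>M\<^esub> n, x \<ominus>\<^bsub>L\<^esub> y)"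
    using gcoset_mem_tr_algebra N assms by (simp add: E.minus_eq_iff)
qed

lemma tr_proj_gcoset:
  assumes "(m, x) \<in> normalizer"
  shows "tr_proj L H (gcoset (m, x)) = H +>\<^bsub>L\<^esub> x"
  unfolding tr_proj_def
proof (rule trans[OF the_elem_image_eqI])
  show "(m, x) \<in> gcoset (m, x)"
    using ext.quot.coset_self[of "(m, x)"] assms by simp
  show "(case q of (m, x) \<Rightarrow> H +>\<^bsub>L\<^esub> x) = H +>\<^bsub>L\<^esub> x" if q: "q \<in> gcoset (m, x)" for q
  proof -
    obtain z where z: "z \<in> H" "q = (d z \<oplus>\<^bsub>M\<^esub> m, z \<oplus>\<^bsub>L\<^esub> x)"
      using q by (auto simp: a_r_coset_def'[of "semidirect M L"] der_graph_def semidirect_sel)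
    have "H +>\<^bsub>L\<^esub> (z \<oplus>\<^bsub>L\<^esub> x) = H +>\<^bsub>L\<^esub> x"
      using normalizer_closed[OF assms] z(1) by (intro quot.coset_eq) (auto simp: a_r_coset_def'[of L])
    with z show ?thesis by simp
  qed
qed simp

text \<open>At x = 0 the normalizer condition reduces to z . n = 0 for z in h.\<close>

lemma annihilated_normalizer: "n \<in> annihilated H M \<Longrightarrow> (n, \<zero>\<^bsub>L\<^esub>) \<in> normalizer"
  by (auto simp: mem_normalizer_iff annihilated_iff act_zero_left der_closed bracket_zero_left
      ideal_carrier der_zero M.minus_simps)

text \<open>The graph contains (m, 0) only for m = d 0 = 0. Injectivity makes the
  \<open>inv_into\<close> in \<open>section_cocycle\<close> an actual inverse on the image.\<close>

lemma tr_incl_inj: "inj_on (tr_incl L H M d) (annihilated H M)"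
proof (rule inj_onI)
  fix m n assume mn: "m \<in> annihilated H M" "n \<in> annihilated H M" "tr_incl L H M d m = tr_incl L H M d n"
  then have "m \<ominus>\<^bsub>M\<^esub> n = \<zero>\<^bsub>M\<^esub>"
    unfolding tr_incl_def
    by (simp add: gcoset_eq_iff annihilated_normalizer a_minus_def[of L] L.M.r_neg der_zero)
  then show "m = n" using mn by (simp add: M.minus_eq_iff annihilated_closed)
qed

end

section \<open>Linear sections and the class of the extension\<close>

context ideal_derivation
begin

text \<open>Linear sections of the extension are exactly the maps \<open>H + x \<mapsto> s\<^sub>d(H) + (\<phi> x, x)\<close> for relative
  cochains \<open>\<phi>\<close> that extend \<open>d\<close>.\<close>

definition lift :: "('g \<Rightarrow> 'm) \<Rightarrow> 'g set \<Rightarrow> ('m \<times> 'g) set" where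
  "lift \<phi> X = (\<lambda>x. (\<phi> x, x)) ` X"

context
  fixes \<phi> assumes \<phi>: "\<phi> \<in> rel_cochains" and ext_d: "\<And>z. z \<in> H \<Longrightarrow> \<phi> z = d z"
begin

lemma rel_cochain_normalizer: "x \<in> carrier L \<Longrightarrow> (\<phi> x, x) \<in> normalizer"
  using rel_cochainsD[OF \<phi>, of x]
  by (simp add: mem_normalizer_iff lin_hom_closed[OF rel_cochains_lin[OF \<phi>]] ext_d[symmetric] ideal_closed)

text \<open>For z in h one has (\<phi> (z + x), z + x) = (d z, z) + (\<phi> x, x), so the pairs over
  a coset of h fill exactly one coset of the graph of d. Hence \<open>lift\<close> involves no
  choice of representatives.\<close>

lemma lift_coset:
  assumes "x \<in> carrier L"
  shows "lift \<phi> (H +>\<^bsub>L\<^esub> x) = gcoset (\<phi> x, x)"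
  using assms lin_hom_add[OF rel_cochains_lin[OF \<phi>] ideal_carrier assms]
  by (auto simp: lift_def a_r_coset_def'[of "semidirect M L"] a_r_coset_def'[of L] der_graph_def
      semidirect_sel ext_d image_iff)

lemma lift_section: "lift \<phi> \<in> sections K (tr_algebra L H M d) (quot_lie L H) (tr_proj L H)"
  unfolding sections_def
  by (auto intro!: lin_homI elim!: quot_lie_cases simp: lift_coset rel_cochain_normalizer
      gcoset_mem_tr_algebra add_quot_lie smult_quot_lie add_tr_algebra smult_tr_algebra tr_proj_gcoset
      lin_hom_add[OF rel_cochains_lin[OF \<phi>]] lin_hom_smult[OF rel_cochains_lin[OF \<phi>]])

lemma section_cocycle_lift:
  "section_cocycle (ideal_invariants H M) (tr_algebra L H M d) (quot_lie L H) (tr_incl L H M d) (lift \<phi>)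
    = tr_cocycle \<phi>"
proof (rule quot_fun_eqI[OF _ tr_cocycle_PiE[OF \<phi>], where A = UNIV])
  fix x y assume xy: "x \<in> carrier L" "y \<in> carrier L"
  note N = rel_cochain_normalizer[OF xy(1)] rel_cochain_normalizer[OF xy(2)]
    rel_cochain_normalizer[OF bracket_closed[OF xy]]
  \<comment> \<open>Both terms lie over [x, y], so their difference has second component zero; its
    first component is the coboundary of \<phi>.\<close>
  have "\<lbrace>lift \<phi> (H +>\<^bsub>L\<^esub> x), lift \<phi> (H +>\<^bsub>L\<^esub> y)\<rbrace>\<^bsub>tr_algebra L H M d\<^esub> \<ominus>\<^bsub>tr_algebra L H M d\<^esub>
      lift \<phi> \<lbrace>H +>\<^bsub>L\<^esub> x, H +>\<^bsub>L\<^esub> y\<rbrace>\<^bsub>quot_lie L H\<^esub> =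
      tr_incl L H M d (coboundary L M \<phi> (x, y))"
    using xy N by (simp add: lift_coset bracket_quot_lie bracket_closed bracket_tr_algebra
        minus_tr_algebra normalizer_bracket tr_incl_def coboundary_apply a_minus_def[of L] L.M.r_neg)
  then show "section_cocycle (ideal_invariants H M) (tr_algebra L H M d) (quot_lie L H)
      (tr_incl L H M d) (lift \<phi>) (H +>\<^bsub>L\<^esub> x, H +>\<^bsub>L\<^esub> y) = tr_cocycle \<phi> (H +>\<^bsub>L\<^esub> x, H +>\<^bsub>L\<^esub> y)"
    using xy by (simp add: section_cocycle_def coset_mem_quot_lie tr_cocycle_coset[OF \<phi>]
        inv_into_f_f[OF tr_incl_inj] coboundary_annihilated[OF \<phi>])
qed (simp add: section_cocycle_def)

end

text \<open>The value of s at H + x contains exactly one pair with second component x: translation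
  by the graph reaches x, and the graph contains (m, 0) only for m = 0. Its first component is
  \<phi> x. Uniqueness makes \<phi> linear, and since s sends the zero coset to the graph, \<phi>
  agrees with d on h.\<close>

lemma section_is_lift:
  assumes s: "s \<in> sections K (tr_algebra L H M d) (quot_lie L H) (tr_proj L H)"
  shows "\<exists>\<phi>\<in>rel_cochains. (\<forall>z\<in>H. \<phi> z = d z) \<and> (\<forall>X\<in>carrier (quot_lie L H). s X = lift \<phi> X)"
proof -
  have s_lin: "s \<in> lin_hom K (quot_lie L H) (tr_algebra L H M d)"
    using s by (simp add: sections_def)
  have s_proj: "tr_proj L H (s (H +>\<^bsub>L\<^esub> x)) = H +>\<^bsub>L\<^esub> x" if "x \<in> carrier L" for x
    using s that by (auto simp: sections_def coset_mem_quot_lie)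
  have uniq: "m = n" if x: "x \<in> carrier L"
    and mn: "(m, x) \<in> normalizer" "s (H +>\<^bsub>L\<^esub> x) = gcoset (m, x)"
      "(n, x) \<in> normalizer" "s (H +>\<^bsub>L\<^esub> x) = gcoset (n, x)" for x m n
  proof -
    have "gcoset (m, x) = gcoset (n, x)" using mn by simp
    then have "m \<ominus>\<^bsub>M\<^esub> n = \<zero>\<^bsub>M\<^esub>"
      using mn x by (simp add: gcoset_eq_iff a_minus_def[of L] L.M.r_neg der_zero)
    then show "m = n" using normalizer_closed mn by (simp add: M.minus_eq_iff)
  qed
  have ex: "\<exists>m. (m, x) \<in> normalizer \<and> s (H +>\<^bsub>L\<^esub> x) = gcoset (m, x)" if x: "x \<in> carrier L" for x
  proof -
    obtain n y where ny: "(n, y) \<in> normalizer" "s (H +>\<^bsub>L\<^esub> x) = gcoset (n, y)"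
      using lin_hom_closed[OF s_lin coset_mem_quot_lie[OF x]] x by (auto elim: tr_algebra_cases)
    note cl = normalizer_closed[OF ny(1)]
    have z: "x \<ominus>\<^bsub>L\<^esub> y \<in> H"
      using s_proj[OF x] tr_proj_gcoset[OF ny(1)] ny(2) cl x quot.coset_eq_iff[of x y] by simp
    \<comment> \<open>Adding the element (d z, z) of the graph shifts the second component from y to
      x without leaving the coset.\<close>
    define z where "z = x \<ominus>\<^bsub>L\<^esub> y"
    have eq: "z \<oplus>\<^bsub>L\<^esub> y = x" using cl x by (simp add: z_def a_minus_def L.M.a_assoc L.M.l_neg)
    have "(d z, z) \<oplus>\<^bsub>semidirect M L\<^esub> (n, y) \<in> gcoset (n, y)"
      using z by (auto simp: a_r_coset_def'[of "semidirect M L"] der_graph_def z_def)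
    then have mem: "(d z \<oplus>\<^bsub>M\<^esub> n, x) \<in> gcoset (n, y)"
      by (simp add: semidirect_sel eq)
    have "(d z \<oplus>\<^bsub>M\<^esub> n, x) \<in> normalizer"
      using ext.quot.coset_subset[of "(n, y)"] mem ny(1) by auto
    moreover have "gcoset (d z \<oplus>\<^bsub>M\<^esub> n, x) = gcoset (n, y)"
      using ext.quot.coset_eq[of "(n, y)" "(d z \<oplus>\<^bsub>M\<^esub> n, x)"] mem ny(1) by simp
    ultimately show ?thesis using ny(2) by auto
  qed
  define \<phi> where "\<phi> x = (SOME m. (m, x) \<in> normalizer \<and> s (H +>\<^bsub>L\<^esub> x) = gcoset (m, x))" for x
  have \<phi>: "(\<phi> x, x) \<in> normalizer" "s (H +>\<^bsub>L\<^esub> x) = gcoset (\<phi> x, x)" if "x \<in> carrier L" for x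
    using someI_ex[OF ex[OF that]] by (simp_all add: \<phi>_def)
  have \<phi>_eqI: "\<phi> x = m" if "(m, x) \<in> normalizer" "s (H +>\<^bsub>L\<^esub> x) = gcoset (m, x)" for x m
    using uniq[OF _ \<phi>] that normalizer_closed by blast
  have ext_d: "\<phi> z = d z" if z: "z \<in> H" for z
  proof (rule \<phi>_eqI)
    interpret E: module K "tr_algebra L H M d"
      unfolding tr_algebra_eq by (rule ext.module_quot_lie)
    have g: "(d z, z) \<in> graph" using z by (simp add: mem_graph_iff)
    then show N: "(d z, z) \<in> normalizer"
      using ext.ideal_carrier by simp
    have "s (H +>\<^bsub>L\<^esub> z) = s \<zero>\<^bsub>quot_lie L H\<^esub>"
      using z by (simp add: zero_quot_lie quot.coset_eq_self_iff[THEN iffD2] ideal_carrier)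
    also have "\<dots> = graph"
      using lin_hom_zero[OF inv.L.M.abelian_group_axioms E.M.abelian_group_axioms s_lin]
      by (simp add: zero_tr_algebra)
    also have "\<dots> = gcoset (d z, z)"
      using ext.quot.coset_eq_self_iff[of "(d z, z)"] g N by simp
    finally show "s (H +>\<^bsub>L\<^esub> z) = gcoset (d z, z)" .
  qed
  have "\<phi> \<in> lin_hom K L M"
  proof (rule lin_homI)
    show "\<phi> x \<in> carrier M" if "x \<in> carrier L" for x
      using normalizer_closed[OF \<phi>(1)[OF that]] by simp
    show "\<phi> (x \<oplus>\<^bsub>L\<^esub> y) = \<phi> x \<oplus>\<^bsub>M\<^esub> \<phi> y" if "x \<in> carrier L" "y \<in> carrier L" for x y
      using that lin_hom_add[OF s_lin coset_mem_quot_lie coset_mem_quot_lie, of x y]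
      by (intro \<phi>_eqI normalizer_add \<phi>) (simp_all add: add_quot_lie \<phi> add_tr_algebra)
    show "\<phi> (c \<odot>\<^bsub>L\<^esub> x) = c \<odot>\<^bsub>M\<^esub> \<phi> x" if "c \<in> carrier K" "x \<in> carrier L" for c x
    proof (rule \<phi>_eqI)
      show "(c \<odot>\<^bsub>M\<^esub> \<phi> x, c \<odot>\<^bsub>L\<^esub> x) \<in> normalizer"
        using ext.L.smult_closed[of c "(\<phi> x, x)"] \<phi>(1) that by (simp add: semidirect_sel)
    qed (use that lin_hom_smult[OF s_lin _ coset_mem_quot_lie, of c x] in
        \<open>simp_all add: smult_quot_lie \<phi> smult_tr_algebra\<close>)
  qed
  \<comment> \<open>For a linear \<phi> that extends d, membership of (\<phi> x, x) in the
    normalizer is the defining equation of relative cochains.\<close>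
  then have rel: "\<phi> \<in> rel_cochains"
    using \<phi>(1) by (auto simp: rel_cochains_def mem_normalizer_iff ext_d ideal_closed)
  have "\<forall>X\<in>carrier (quot_lie L H). s X = lift \<phi> X"
    by (auto elim!: quot_lie_cases simp: \<phi>(2) lift_coset[OF rel ext_d])
  with rel ext_d show ?thesis by blast
qed

lemma tr_hat_eq:
  assumes \<phi>: "\<phi> \<in> rel_cochains" and ext_d: "\<And>z. z \<in> H \<Longrightarrow> \<phi> z = d z"
  shows "tr_hat K L H M d = H2_class K (quot_lie L H) (ideal_invariants H M) (tr_cocycle \<phi>)"
  unfolding tr_hat_def extension_class_def
proof (rule the_elem_image_eqI)
  show "lift \<phi> \<in> sections K (tr_algebra L H M d) (quot_lie L H) (tr_proj L H)"
    by (rule lift_section[OF assms])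
  fix s assume s: "s \<in> sections K (tr_algebra L H M d) (quot_lie L H) (tr_proj L H)"
  from section_is_lift[OF s]
  obtain \<psi> where \<psi>: "\<psi> \<in> rel_cochains" "\<And>z. z \<in> H \<Longrightarrow> \<psi> z = d z"
    and s_lift: "\<And>X. X \<in> carrier (quot_lie L H) \<Longrightarrow> s X = lift \<psi> X"
    by blast
  \<comment> \<open>The maps s and \<open>lift \<psi>\<close> agree only on the carrier, which is
    all that \<open>section_cocycle\<close> evaluates.\<close>
  have "section_cocycle (ideal_invariants H M) (tr_algebra L H M d) (quot_lie L H) (tr_incl L H M d) s
      = section_cocycle (ideal_invariants H M) (tr_algebra L H M d) (quot_lie L H) (tr_incl L H M d) (lift \<psi>)"
    unfolding section_cocycle_def by (intro restrict_ext) (auto simp: s_lift inv.bracket_closed)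
  also have "\<dots> = tr_cocycle \<psi>"
    by (rule section_cocycle_lift[OF \<psi>])
  finally show "H2_class K (quot_lie L H) (ideal_invariants H M)
      (section_cocycle (ideal_invariants H M) (tr_algebra L H M d) (quot_lie L H) (tr_incl L H M d) s) =
      H2_class K (quot_lie L H) (ideal_invariants H M) (tr_cocycle \<phi>)"
    using tr_cocycle_class_eq[OF \<psi>(1) \<phi>] ext_d \<psi>(2) by simp
qed

text \<open>An m whose inner derivation is the action of x on d puts (m, x) in the normalizer, so
  invariance makes the projection to g onto. As this projection is injective on the graph, a section
  can be prescribed to send z to (d z, z); its first component is the cochain.\<close>

lemma ex_rel_cochain:
  assumes inv: "\<And>x. x \<in> carrier L \<Longrightarrow> der_act L H M x d \<in> Inn (L\<lparr>carrier := H\<rparr>) M"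
  shows "\<exists>\<phi>\<in>rel_cochains. \<forall>z\<in>H. \<phi> z = d z"
proof -
  let ?V = "(semidirect M L)\<lparr>carrier := normalizer\<rparr>"
  have "snd \<in> lin_hom K ?V L"
    by (rule lin_homI) (auto simp: semidirect_sel dest: normalizer_closed)
  moreover have "snd ` carrier ?V = carrier L"
  proof
    show "carrier L \<subseteq> snd ` carrier ?V"
    proof
      fix x assume x: "x \<in> carrier L"
      then obtain m where m: "m \<in> carrier M" "der_act L H M x d = (\<lambda>z\<in>H. z \<rhd>\<^bsub>M\<^esub> m)"
        using inv[OF x] by (auto simp: Inn_def)
      have "(x \<rhd>\<^bsub>M\<^esub> d z) \<ominus>\<^bsub>M\<^esub> (z \<rhd>\<^bsub>M\<^esub> m) = d \<lbrace>x, z\<rbrace>\<^bsub>L\<^esub>" if z: "z \<in> H" for z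
        using fun_cong[OF m(2), of z] z x m(1)
        by (simp add: der_act_def ideal_carrier der_closed act_closed ideal_closed M.minus_simps)
      then have "(m, x) \<in> carrier ?V" using m x by (simp add: mem_normalizer_iff)
      then show "x \<in> snd ` carrier ?V" by force
    qed
  qed (auto dest: normalizer_closed)
  moreover have "inj_on snd graph"
    by (auto simp: der_graph_def inj_on_def)
  ultimately have "\<exists>s\<in>lin_hom K L ?V. (\<forall>x\<in>carrier L. snd (s x) = x) \<and> (\<forall>p\<in>graph. s (snd p) = p)"
    by (rule linear_section_extending[OF K.field_axioms ext.L.module_axioms L.module_axioms _ _
        ext.submodule_axioms])
  then obtain s where s: "s \<in> lin_hom K L ?V" "\<And>x. x \<in> carrier L \<Longrightarrow> snd (s x) = x"
    "\<And>p. p \<in> graph \<Longrightarrow> s (snd p) = p"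
    by blast
  have sN: "(fst (s x), x) \<in> normalizer" if "x \<in> carrier L" for x
    using lin_hom_closed[OF s(1) that] s(2)[OF that] by (cases "s x") auto
  have sd: "fst (s z) = d z" if "z \<in> H" for z
    using s(3)[of "(d z, z)"] that by (simp add: mem_graph_iff)
  have "(\<lambda>x. fst (s x)) \<in> lin_hom K L M"
    using normalizer_closed[OF sN] lin_hom_add[OF s(1)] lin_hom_smult[OF s(1)]
    by (intro lin_homI) (auto simp: semidirect_def case_prod_beta)
  then have "(\<lambda>x. fst (s x)) \<in> rel_cochains"
    using sN by (auto simp: rel_cochains_def mem_normalizer_iff sd ideal_closed)
  then show ?thesis
    by (rule bexI[rotated]) (simp add: sd)
qed

end

section \<open>Exactness\<close>

context lie_ideal_module
begin

text \<open>For x in h the defining equation of relative cochains is the derivation rule.\<close>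

lemma restrict_rel_cochain_Der:
  assumes \<phi>: "\<phi> \<in> rel_cochains"
  shows "restrict \<phi> H \<in> Der K (L\<lparr>carrier := H\<rparr>) M"
  unfolding Der_def using rel_cochainsD[OF \<phi>]
  by (auto intro!: lin_homI simp: lin_hom_closed[OF rel_cochains_lin[OF \<phi>]]
      lin_hom_add[OF rel_cochains_lin[OF \<phi>]] lin_hom_smult[OF rel_cochains_lin[OF \<phi>]]
      ideal_carrier ideal_add smult_closed ideal_closed)

lemma ideal_derivationI: "d \<in> Der K (L\<lparr>carrier := H\<rparr>) M \<Longrightarrow> ideal_derivation H K L M d"
  by (intro ideal_derivation.intro ideal_derivation_axioms.intro lie_ideal_module_axioms)

abbreviation "Inn_ideal \<equiv> Inn (L\<lparr>carrier := H\<rparr>) M"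

lemma Inn_ideal_eq: "Inn_ideal = (\<lambda>n. \<lambda>z\<in>H. z \<rhd>\<^bsub>M\<^esub> n) ` carrier M"
  by (simp add: Inn_def)

lemma submodule_Inn_ideal: "submodule Inn_ideal K (fun_module H M)"
proof (rule module.submoduleI_smult[OF M.module_fun_module])
  show "Inn_ideal \<subseteq> carrier (fun_module H M)"
    by (auto simp: Inn_ideal_eq fun_module_def act_closed ideal_carrier)
  show "\<zero>\<^bsub>fun_module H M\<^esub> \<in> Inn_ideal"
    unfolding Inn_ideal_eq by (rule image_eqI[of _ _ "\<zero>\<^bsub>M\<^esub>"])
      (auto simp: fun_module_def act_zero_right ideal_carrier intro!: restrict_ext)
  show "a \<oplus>\<^bsub>fun_module H M\<^esub> b \<in> Inn_ideal" if "a \<in> Inn_ideal" "b \<in> Inn_ideal" for a b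
  proof -
    from that obtain m n where "m \<in> carrier M" "n \<in> carrier M"
      "a = (\<lambda>z\<in>H. z \<rhd>\<^bsub>M\<^esub> m)" "b = (\<lambda>z\<in>H. z \<rhd>\<^bsub>M\<^esub> n)" by (auto simp: Inn_ideal_eq)
    then show ?thesis
      unfolding Inn_ideal_eq by (intro image_eqI[of _ _ "m \<oplus>\<^bsub>M\<^esub> n"])
        (auto simp: fun_module_def act_add_right ideal_carrier intro!: restrict_ext)
  qed
  show "c \<odot>\<^bsub>fun_module H M\<^esub> a \<in> Inn_ideal" if "c \<in> carrier K" "a \<in> Inn_ideal" for c a
  proof -
    from that obtain m where "m \<in> carrier M" "a = (\<lambda>z\<in>H. z \<rhd>\<^bsub>M\<^esub> m)" by (auto simp: Inn_ideal_eq)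
    then show ?thesis
      unfolding Inn_ideal_eq using that(1) by (intro image_eqI[of _ _ "c \<odot>\<^bsub>M\<^esub> m"])
        (auto simp: fun_module_def act_smult_right ideal_carrier intro!: restrict_ext)
  qed
qed

sublocale ders: module_quotient K "fun_module H M" Inn_ideal
  by (intro module_quotient.intro submodule_Inn_ideal M.module_fun_module)

section \<open>Invariant classes in degree one and the map \<open>tr\<close> on them\<close>

definition H1_class :: "('g \<Rightarrow> 'm) \<Rightarrow> ('g \<Rightarrow> 'm) set" where
  "H1_class d = Inn_ideal +>\<^bsub>fun_module H M\<^esub> d"

lemma H1_sel:
  "carrier (H1 K (L\<lparr>carrier := H\<rparr>) M) = H1_class ` Der K (L\<lparr>carrier := H\<rparr>) M"
  "add (H1 K (L\<lparr>carrier := H\<rparr>) M) = add (quot_module (fun_module H M) Inn_ideal)"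
  "smult (H1 K (L\<lparr>carrier := H\<rparr>) M) = smult (quot_module (fun_module H M) Inn_ideal)"
  "zero (H1 K (L\<lparr>carrier := H\<rparr>) M) = Inn_ideal"
  by (simp_all add: H1_def quot_module_carrier_update H1_class_def[abs_def] ders.zero_quot)

lemma H1_invariants_sel:
  "add (H1_invariants K L H M) = add (quot_module (fun_module H M) Inn_ideal)"
  "smult (H1_invariants K L H M) = smult (quot_module (fun_module H M) Inn_ideal)"
  by (simp_all add: H1_invariants_def H1_ideal_def Let_def H1_sel)

lemma carrier_H1_invariants_raw:
  "C \<in> carrier (H1_invariants K L H M) \<longleftrightarrow> C \<in> H1_class ` Der K (L\<lparr>carrier := H\<rparr>) M \<and>
    (\<forall>x\<in>carrier L. (\<Union>y\<in>H +>\<^bsub>L\<^esub> x. \<Union>d\<in>C. H1_class (der_act L H M y d)) = Inn_ideal)"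
  by (simp add: H1_invariants_def annihilated_def H1_ideal_def Let_def H1_sel carrier_quot_lie
      H1_class_def)

lemma restrict_fun_module: "\<phi> \<in> rel_cochains \<Longrightarrow> restrict \<phi> H \<in> carrier (fun_module H M)"
  by (auto simp: fun_module_def lin_hom_closed[OF rel_cochains_lin] ideal_carrier)

text \<open>Inner derivations of h extend to the cochains x |-> x . n on g, which are relative, so
  all representatives of the class are handled by relative cochains.\<close>

lemma mem_H1_class_restrict:
  assumes \<phi>: "\<phi> \<in> rel_cochains"
  shows "d \<in> H1_class (restrict \<phi> H) \<longleftrightarrow>
    (\<exists>n\<in>carrier M. d = restrict (\<lambda>x. (x \<rhd>\<^bsub>M\<^esub> n) \<oplus>\<^bsub>M\<^esub> \<phi> x) H)"
proof -
  have "(\<lambda>z\<in>H. z \<rhd>\<^bsub>M\<^esub> n) \<oplus>\<^bsub>fun_module H M\<^esub> restrict \<phi> H = restrict (\<lambda>x. (x \<rhd>\<^bsub>M\<^esub> n) \<oplus>\<^bsub>M\<^esub> \<phi> x) H" for n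
    by (auto simp: fun_module_def intro!: restrict_ext)
  then show ?thesis
    by (auto simp: H1_class_def a_r_coset_def' Inn_ideal_eq)
qed

text \<open>Solving the defining equation for z . \<phi> x shows that \<phi> x itself is the element
  whose inner derivation witnesses invariance under x.\<close>

lemma der_act_restrict:
  assumes \<phi>: "\<phi> \<in> rel_cochains" and x: "x \<in> carrier L"
  shows "der_act L H M x (restrict \<phi> H) = (\<lambda>z\<in>H. z \<rhd>\<^bsub>M\<^esub> \<phi> x)"
  unfolding der_act_def
proof (rule restrict_ext)
  fix z assume z: "z \<in> H"
  have "(x \<rhd>\<^bsub>M\<^esub> \<phi> z) \<ominus>\<^bsub>M\<^esub> \<phi> \<lbrace>x, z\<rbrace>\<^bsub>L\<^esub> = z \<rhd>\<^bsub>M\<^esub> \<phi> x"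
    using rel_cochainsD[OF \<phi> x z, symmetric] x z lin_hom_closed[OF rel_cochains_lin[OF \<phi>]]
    by (simp add: ideal_carrier act_closed M.minus_simps)
  then show "(x \<rhd>\<^bsub>M\<^esub> restrict \<phi> H z) \<ominus>\<^bsub>M\<^esub> restrict \<phi> H \<lbrace>x, z\<rbrace>\<^bsub>L\<^esub> = z \<rhd>\<^bsub>M\<^esub> \<phi> x"
    using x z by (simp add: ideal_closed)
qed

text \<open>Invariance makes \<open>ex_rel_cochain\<close> applicable; conversely
  \<open>der_act_restrict\<close> shows that each x acts on every representative with an inner
  result. Invariant classes can then be treated through \<phi> alone.\<close>

lemma carrier_H1_invariants:
  "carrier (H1_invariants K L H M) = (\<lambda>\<phi>. H1_class (restrict \<phi> H)) ` rel_cochains"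
proof (intro equalityI subsetI)
  fix C assume C: "C \<in> carrier (H1_invariants K L H M)"
  then obtain d where d: "d \<in> Der K (L\<lparr>carrier := H\<rparr>) M" "C = H1_class d"
    by (auto simp: carrier_H1_invariants_raw)
  interpret ideal_derivation H K L M d
    by (rule ideal_derivationI[OF d(1)])
  have dF: "d \<in> carrier (fun_module H M)"
    using d(1) by (auto simp: fun_module_def der_closed Der_def PiE_iff)
  have "der_act L H M x d \<in> Inn_ideal" if x: "x \<in> carrier L" for x
  proof -
    have "der_act L H M x d \<in> carrier (fun_module H M)"
      using x by (auto simp: der_act_def fun_module_def act_closed der_closed ideal_closed)
    \<comment> \<open>A coset contains its representative; since the union over all representatives
      is \<open>Inn_ideal\<close>, this function is inner.\<close>
    then have "der_act L H M x d \<in> H1_class (der_act L H M x d)"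
      unfolding H1_class_def by (rule ders.coset_self)
    moreover have "d \<in> C"
      unfolding d(2) H1_class_def using dF by (rule ders.coset_self)
    moreover have "(\<Union>y\<in>H +>\<^bsub>L\<^esub> x. \<Union>d\<in>C. H1_class (der_act L H M y d)) = Inn_ideal"
      using C x by (simp add: carrier_H1_invariants_raw)
    ultimately show ?thesis
      using quot.coset_self[OF x] by blast
  qed
  from ex_rel_cochain[OF this] obtain \<phi> where \<phi>: "\<phi> \<in> rel_cochains" "\<And>z. z \<in> H \<Longrightarrow> \<phi> z = d z"
    by blast
  have "d = restrict \<phi> H"
    using d(1) \<phi>(2) by (intro extensionalityI[of _ H]) (auto simp: Der_def)
  with \<phi>(1) d(2) show "C \<in> (\<lambda>\<phi>. H1_class (restrict \<phi> H)) ` rel_cochains" by blast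
next
  fix C assume "C \<in> (\<lambda>\<phi>. H1_class (restrict \<phi> H)) ` rel_cochains"
  then obtain \<phi> where \<phi>: "\<phi> \<in> rel_cochains" "C = H1_class (restrict \<phi> H)" by blast
  have "H1_class (der_act L H M y d) = Inn_ideal"
    if y: "y \<in> carrier L" and dC: "d \<in> C" for y d
  proof -
    obtain n where n: "n \<in> carrier M" "d = restrict (\<lambda>x. (x \<rhd>\<^bsub>M\<^esub> n) \<oplus>\<^bsub>M\<^esub> \<phi> x) H"
      using dC unfolding \<phi>(2) mem_H1_class_restrict[OF \<phi>(1)] by blast
    \<comment> \<open>The chosen representative is the restriction of this relative cochain, so
      \<open>der_act_restrict\<close> applies to it.\<close>
    have rel: "(\<lambda>x. (x \<rhd>\<^bsub>M\<^esub> n) \<oplus>\<^bsub>M\<^esub> \<phi> x) \<in> rel_cochains"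
      by (intro rel_cochains_add rel_cochains_inner n \<phi>)
    have "der_act L H M y d \<in> Inn_ideal"
      unfolding n(2) der_act_restrict[OF rel y] Inn_ideal_eq
      using lin_hom_closed[OF rel_cochains_lin[OF rel] y] by blast
    then show ?thesis
      unfolding H1_class_def using ders.subset by (subst ders.coset_eq_self_iff) auto
  qed
  moreover have "restrict \<phi> H \<in> C"
    unfolding \<phi>(2) H1_class_def by (rule ders.coset_self[OF restrict_fun_module[OF \<phi>(1)]])
  ultimately have "(\<Union>y\<in>H +>\<^bsub>L\<^esub> x. \<Union>d\<in>C. H1_class (der_act L H M y d)) = Inn_ideal"
    if x: "x \<in> carrier L" for x
    using quot.coset_self[OF x] quot.coset_subset[OF x] by (intro UN_eq_constI) auto
  then show "C \<in> carrier (H1_invariants K L H M)"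
    using \<phi> restrict_rel_cochain_Der by (auto simp: carrier_H1_invariants_raw)
qed

text \<open>All derivations in the class extend to \<phi> plus an inner cochain, and
  \<open>tr_cocycle_add_inner\<close> gives these the same cocycle, so \<open>the_elem\<close>
  selects its class.\<close>

lemma tr_class:
  assumes \<phi>: "\<phi> \<in> rel_cochains"
  shows "tr K L H M (H1_class (restrict \<phi> H)) =
    H2_class K (quot_lie L H) (ideal_invariants H M) (tr_cocycle \<phi>)"
  unfolding tr_def
proof (rule the_elem_image_eqI)
  show "restrict \<phi> H \<in> H1_class (restrict \<phi> H)"
    unfolding H1_class_def by (rule ders.coset_self[OF restrict_fun_module[OF \<phi>]])
  fix d assume "d \<in> H1_class (restrict \<phi> H)"
  then obtain n where n: "n \<in> carrier M" "d = restrict (\<lambda>x. (x \<rhd>\<^bsub>M\<^esub> n) \<oplus>\<^bsub>M\<^esub> \<phi> x) H"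
    using mem_H1_class_restrict[OF \<phi>] by auto
  have rel: "(\<lambda>x. (x \<rhd>\<^bsub>M\<^esub> n) \<oplus>\<^bsub>M\<^esub> \<phi> x) \<in> rel_cochains"
    by (intro rel_cochains_add rel_cochains_inner n \<phi>)
  interpret ideal_derivation H K L M d
    unfolding n(2) by (rule ideal_derivationI[OF restrict_rel_cochain_Der[OF rel]])
  show "tr_hat K L H M d = H2_class K (quot_lie L H) (ideal_invariants H M) (tr_cocycle \<phi>)"
    using tr_hat_eq[OF rel] n \<phi> by (simp add: tr_cocycle_add_inner)
qed

section \<open>Linearity of both maps and the kernel of inflation\<close>

lemma tr_linear:
  "tr K L H M \<in> lin_hom K (H1_invariants K L H M) (H2 K (quot_lie L H) (ideal_invariants H M))"
proof (rule lin_homI)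
  show "tr K L H M C \<in> carrier (H2 K (quot_lie L H) (ideal_invariants H M))"
    if "C \<in> carrier (H1_invariants K L H M)" for C
    using that by (auto simp: carrier_H1_invariants tr_class inv.carrier_H2 tr_cocycle_Z2)
  show "tr K L H M (C \<oplus>\<^bsub>H1_invariants K L H M\<^esub> D) =
      tr K L H M C \<oplus>\<^bsub>H2 K (quot_lie L H) (ideal_invariants H M)\<^esub> tr K L H M D"
    if CD: "C \<in> carrier (H1_invariants K L H M)" "D \<in> carrier (H1_invariants K L H M)" for C D
  proof -
    obtain \<phi> \<psi> where \<phi>: "\<phi> \<in> rel_cochains" "C = H1_class (restrict \<phi> H)"
      and \<psi>: "\<psi> \<in> rel_cochains" "D = H1_class (restrict \<psi> H)"
      using CD unfolding carrier_H1_invariants by blast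
    \<comment> \<open>Sums of classes are represented by sums of relative cochains, on which
      \<open>tr_cocycle\<close> is additive.\<close>
    have "restrict \<phi> H \<oplus>\<^bsub>fun_module H M\<^esub> restrict \<psi> H = restrict (\<lambda>x. \<phi> x \<oplus>\<^bsub>M\<^esub> \<psi> x) H"
      by (auto simp: fun_module_def intro!: restrict_ext)
    then have "C \<oplus>\<^bsub>H1_invariants K L H M\<^esub> D = H1_class (restrict (\<lambda>x. \<phi> x \<oplus>\<^bsub>M\<^esub> \<psi> x) H)"
      using ders.add_quot[OF restrict_fun_module[OF \<phi>(1)] restrict_fun_module[OF \<psi>(1)]]
      by (simp add: \<phi> \<psi> H1_invariants_sel H1_class_def)
    then show ?thesis
      using tr_cocycle_PiE[OF \<phi>(1)] tr_cocycle_PiE[OF \<psi>(1)] \<phi> \<psi>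
      by (simp add: tr_class rel_cochains_add tr_cocycle_add inv.add_H2)
  qed
  show "tr K L H M (c \<odot>\<^bsub>H1_invariants K L H M\<^esub> C) =
      c \<odot>\<^bsub>H2 K (quot_lie L H) (ideal_invariants H M)\<^esub> tr K L H M C"
    if c: "c \<in> carrier K" and CD: "C \<in> carrier (H1_invariants K L H M)" for c C
  proof -
    obtain \<phi> where \<phi>: "\<phi> \<in> rel_cochains" "C = H1_class (restrict \<phi> H)"
      using CD unfolding carrier_H1_invariants by blast
    have "c \<odot>\<^bsub>fun_module H M\<^esub> restrict \<phi> H = restrict (\<lambda>x. c \<odot>\<^bsub>M\<^esub> \<phi> x) H"
      by (auto simp: fun_module_def intro!: restrict_ext)
    then have "c \<odot>\<^bsub>H1_invariants K L H M\<^esub> C = H1_class (restrict (\<lambda>x. c \<odot>\<^bsub>M\<^esub> \<phi> x) H)"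
      using ders.smult_quot[OF c restrict_fun_module[OF \<phi>(1)]]
      by (simp add: \<phi> H1_invariants_sel H1_class_def)
    then show ?thesis
      using tr_cocycle_PiE[OF \<phi>(1)] \<phi> c
      by (simp add: tr_class rel_cochains_smult tr_cocycle_smult inv.smult_H2)
  qed
qed

lemma Z2_PiE: "f \<in> Z2 K (quot_lie L H) (ideal_invariants H M) \<Longrightarrow>
    f \<in> carrier (quot_lie L H) \<times> carrier (quot_lie L H) \<rightarrow>\<^sub>E annihilated H M"
  by (simp add: Z2_def)

lemma inflate_PiE:
  "f \<in> Z2 K (quot_lie L H) (ideal_invariants H M) \<Longrightarrow>
    inflate L H f \<in> carrier L \<times> carrier L \<rightarrow>\<^sub>E carrier M"
  using inflate_Z2[of f] by (simp add: Z2_def)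

lemma inflation_linear:
  "inflation K L H M \<in> lin_hom K (H2 K (quot_lie L H) (ideal_invariants H M)) (H2 K L M)"
proof (rule lin_homI)
  let ?F = "fun_module (carrier (quot_lie L H) \<times> carrier (quot_lie L H)) (ideal_invariants H M)"
  show "inflation K L H M C \<in> carrier (H2 K L M)"
    if "C \<in> carrier (H2 K (quot_lie L H) (ideal_invariants H M))" for C
    using that by (auto simp: inv.carrier_H2 carrier_H2 inflation_class Z2_PiE inflate_Z2)
  show "inflation K L H M (C \<oplus>\<^bsub>H2 K (quot_lie L H) (ideal_invariants H M)\<^esub> D) =
      inflation K L H M C \<oplus>\<^bsub>H2 K L M\<^esub> inflation K L H M D"
    if CD: "C \<in> carrier (H2 K (quot_lie L H) (ideal_invariants H M))"
      "D \<in> carrier (H2 K (quot_lie L H) (ideal_invariants H M))" for C D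
  proof -
    obtain f g where f: "f \<in> Z2 K (quot_lie L H) (ideal_invariants H M)"
        "C = H2_class K (quot_lie L H) (ideal_invariants H M) f"
      and g: "g \<in> Z2 K (quot_lie L H) (ideal_invariants H M)"
        "D = H2_class K (quot_lie L H) (ideal_invariants H M) g"
      using CD unfolding inv.carrier_H2 by blast
    have "f \<oplus>\<^bsub>?F\<^esub> g \<in> carrier (quot_lie L H) \<times> carrier (quot_lie L H) \<rightarrow>\<^sub>E annihilated H M"
      using inv.cochains.V.M.a_closed[of f g] Z2_PiE[OF f(1)] Z2_PiE[OF g(1)] by (simp add: fun_module_def)
    \<comment> \<open>Pulling functions back along the projection commutes with pointwise
      operations.\<close>
    moreover have "inflate L H (f \<oplus>\<^bsub>?F\<^esub> g) =
        inflate L H f \<oplus>\<^bsub>fun_module (carrier L \<times> carrier L) M\<^esub> inflate L H g"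
      by (auto simp: inflate_def fun_module_def coset_mem_quot_lie intro!: restrict_ext)
    ultimately show ?thesis
      by (simp add: f g inv.add_H2 Z2_PiE inflation_class add_H2 inflate_PiE)
  qed
  show "inflation K L H M (c \<odot>\<^bsub>H2 K (quot_lie L H) (ideal_invariants H M)\<^esub> C) =
      c \<odot>\<^bsub>H2 K L M\<^esub> inflation K L H M C"
    if c: "c \<in> carrier K" and CD: "C \<in> carrier (H2 K (quot_lie L H) (ideal_invariants H M))" for c C
  proof -
    obtain f where f: "f \<in> Z2 K (quot_lie L H) (ideal_invariants H M)"
        "C = H2_class K (quot_lie L H) (ideal_invariants H M) f"
      using CD unfolding inv.carrier_H2 by blast
    have "c \<odot>\<^bsub>?F\<^esub> f \<in> carrier (quot_lie L H) \<times> carrier (quot_lie L H) \<rightarrow>\<^sub>E annihilated H M"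
      using inv.cochains.V.smult_closed[of c f] Z2_PiE[OF f(1)] c by (simp add: fun_module_def)
    moreover have "inflate L H (c \<odot>\<^bsub>?F\<^esub> f) =
        c \<odot>\<^bsub>fun_module (carrier L \<times> carrier L) M\<^esub> inflate L H f"
      by (auto simp: inflate_def fun_module_def coset_mem_quot_lie intro!: restrict_ext)
    ultimately show ?thesis
      using c by (simp add: f inv.smult_H2 Z2_PiE inflation_class smult_H2 inflate_PiE)
  qed
qed

lemma tr_image_eq_kernel:
  "tr K L H M ` carrier (H1_invariants K L H M) =
    a_kernel (H2 K (quot_lie L H) (ideal_invariants H M)) (H2 K L M) (inflation K L H M)"
proof (intro equalityI subsetI)
  fix C assume "C \<in> tr K L H M ` carrier (H1_invariants K L H M)"
  then obtain \<phi> where \<phi>: "\<phi> \<in> rel_cochains"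
    and C: "C = H2_class K (quot_lie L H) (ideal_invariants H M) (tr_cocycle \<phi>)"
    by (auto simp: carrier_H1_invariants tr_class)
  note Z = tr_cocycle_Z2[OF \<phi>]
  have "coboundary L M \<phi> \<in> B2 K L M"
    using rel_cochains_lin[OF \<phi>] by (simp add: B2_eq)
  then have "inflation K L H M C = B2 K L M"
    using coboundary_PiE[OF rel_cochains_lin[OF \<phi>]]
    by (simp add: C inflation_class Z2_PiE[OF Z] inflate_tr_cocycle[OF \<phi>] H2_class_eq_zero_iff)
  then show "C \<in> a_kernel (H2 K (quot_lie L H) (ideal_invariants H M)) (H2 K L M) (inflation K L H M)"
    using Z by (simp add: a_kernel_def' C inv.carrier_H2 zero_H2)
next
  fix C assume "C \<in> a_kernel (H2 K (quot_lie L H) (ideal_invariants H M)) (H2 K L M) (inflation K L H M)"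
  then obtain f where f: "f \<in> Z2 K (quot_lie L H) (ideal_invariants H M)"
    and C: "C = H2_class K (quot_lie L H) (ideal_invariants H M) f" "inflation K L H M C = B2 K L M"
    by (auto simp: a_kernel_def' inv.carrier_H2 zero_H2)
  have "inflate L H f \<in> B2 K L M"
    using C f by (simp add: inflation_class Z2_PiE H2_class_eq_zero_iff inflate_PiE)
  \<comment> \<open>The inflated cocycle is the coboundary of this \<phi>; the restriction of \<phi>
    to h is the derivation whose class is the required preimage.\<close>
  then obtain \<phi> where \<phi>: "\<phi> \<in> lin_hom K L M" "inflate L H f = coboundary L M \<phi>"
    by (auto simp: B2_eq)
  have rel: "\<phi> \<in> rel_cochains"
    by (rule rel_cochain_if_inflate[OF f \<phi>])
  \<comment> \<open>By \<open>tr_cocycle_unique\<close> the cocycle f itself equals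
    \<open>tr_cocycle \<phi>\<close>, so no correction by a coboundary of g/h arises.\<close>
  have "C = tr K L H M (H1_class (restrict \<phi> H))"
    by (simp add: C(1) tr_class[OF rel] tr_cocycle_unique[OF Z2_PiE[OF f] rel \<phi>(2)])
  then show "C \<in> tr K L H M ` carrier (H1_invariants K L H M)"
    using rel by (auto simp: carrier_H1_invariants)
qed

end

theorem corollary5p11:
  fixes K :: "('k, 'c) ring_scheme"
    and \<gg> :: "('k, 'g, 'd) lie_algebra_scheme"
    and \<hh> :: "'g set"
    and M :: "('k, 'g, 'm, 'e) lie_module_scheme"
  assumes "field K"
    and "lie_algebra K \<gg>"
    and "lie_ideal \<hh> K \<gg>"
    and "lie_module K \<gg> M"
  shows "exact_at K
    (H1_invariants K \<gg> \<hh> M) (tr K \<gg> \<hh> M)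
    (H2 K (quot_lie \<gg> \<hh>) (ideal_invariants \<hh> M)) (inflation K \<gg> \<hh> M)
    (H2 K \<gg> M)"
proof -
  interpret lie_ideal_module \<hh> K \<gg> M
    using assms(3,4) by (rule lie_ideal_module.intro)
  show ?thesis
    unfolding exact_at_def using tr_linear inflation_linear tr_image_eq_kernel by blast
qed

end
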